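(* Let $n\ge 1$. The map $A\colon\mathbf{Nc}(n+1)\to\mathbf A(\operatorname{mod}\Lambda_n)$, which sends a non-crossing partition $P$ of $\{1,2,\dots,n+1\}$ to the set $A(P)$ of all $\Lambda_n$-modules $[a,b]$ such that $[a,b]$ is an arc of $P$, is a poset isomorphism.
   Context: A partition of $\{1,\dots,n+1\}$ is non-crossing if, whenever $i<i'<j<j'$ with $i,j$ in the same part and $i',j'$ in the same part, all four elements belong to the same part. $\mathbf{Nc}(n+1)$ is the set of non-crossing partitions of $\{1,\dots,n+1\}$, ordered by $P\le P'$ iff every part of $P$ is contained in a part of $P'$. An arc of a partition $P$ is a pair $[a,b]$ with $a<b$ in the same part of $P$ such that no $c$ with $a<c<b$ belongs to this part. $\Lambda_n$ is the path algebra over a field of the quiver $1\leftarrow 2\leftarrow\cdots\leftarrow n$, with simple modules $S(i)$. For $1\le a<b\le n+1$, $[a,b]$ also denotes the indecomposable $\Lambda_n$-module with composition factors $S(a),\dots,S(b-1)$ (each once) and socle $S(a)$; these are all the indecomposable $\Lambda_n$-modules. An antichain in $\operatorname{mod}\Lambda_n$ is a set of pairwise orthogonal bricks (a brick is a module whose endomorphism ring is a division ring; orthogonal means that there are no non-zero homomorphisms in either direction), taken up to isomorphism. It is exceptional if its Ext-quiver (vertices: its elements; an arrow $X\to Y$ iff $\operatorname{Ext}^1(X,Y)\ne0$) has no oriented cycle (for $\Lambda_n$ this holds for all antichains). $\mathbf A(\operatorname{mod}\Lambda_n)$ is the set of exceptional antichains, ordered by $A\le A'$ iff every element of $A$ has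 a filtration with factors in $A'$. *)

theory Defs
  imports
    "HOL-Library.Disjoint_Sets"
    "HOL-Library.Function_Algebras"
    "Graph_Theory.Arc_Walk"
begin

section \<open>Posets\<close>

definition poset_isomorphism ::
  "'a set \<Rightarrow> ('a \<times> 'a) set \<Rightarrow> 'b set \<Rightarrow> ('b \<times> 'b) set \<Rightarrow> ('a \<Rightarrow> 'b) \<Rightarrow> bool" where
  "poset_isomorphism S r T s f \<longleftrightarrow>
     partial_order_on S r \<and> partial_order_on T s \<and> bij_betw f S T \<and>
     (\<forall>x\<in>S. \<forall>y\<in>S. (x, y) \<in> r \<longleftrightarrow> (f x, f y) \<in> s)"

section \<open>Non-crossing partitions\<close>

definition noncrossing :: "nat set set \<Rightarrow> bool" where
  "noncrossing P \<longleftrightarrow>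
     (\<forall>B\<in>P. \<forall>B'\<in>P. \<forall>i i' j j'.
        i < i' \<and> i' < j \<and> j < j' \<and> i \<in> B \<and> j \<in> B \<and> i' \<in> B' \<and> j' \<in> B' \<longrightarrow> B = B')"

definition Nc :: "nat \<Rightarrow> nat set set set" where
  "Nc m = {P. partition_on {1..m} P \<and> noncrossing P}"

definition Nc_order :: "nat \<Rightarrow> (nat set set \<times> nat set set) set" where
  "Nc_order m = {(P, P'). P \<in> Nc m \<and> P' \<in> Nc m \<and> (\<forall>B\<in>P. \<exists>B'\<in>P'. B \<subseteq> B')}"

definition is_arc :: "nat set set \<Rightarrow> nat \<Rightarrow> nat \<Rightarrow> bool" where
  "is_arc P a b \<longleftrightarrow>
     a < b \<and> (\<exists>B\<in>P. a \<in> B \<and> b \<in> B \<and> (\<forall>c. a < c \<and> c < b \<longrightarrow> c \<notin> B))"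

section \<open>Path algebras\<close>

text \<open>
  A quiver is a directed multigraph. A path is a triple \<open>(u, p, v)\<close>: start vertex, list of
  arrows in the order in which they are traversed, end vertex; \<open>(u, [], u)\<close> is the trivial path.
\<close>

definition paths :: "('a, 'b) pre_digraph \<Rightarrow> ('a \<times> 'b list \<times> 'a) set" where
  "paths Q = {(u, p, v). pre_digraph.awalk Q u p v}"

type_synonym ('a, 'b, 'k) path_comb = "'a \<times> 'b list \<times> 'a \<Rightarrow> 'k"

text \<open>
  Elements of the path algebra are finitely supported functions on paths, with pointwise
  addition; the algebra multiplication is \<open>pa_mult\<close>, not the pointwise product of functions.
\<close>

definition path_algebra :: "('a, 'b) pre_digraph \<Rightarrow> ('a, 'b, 'k::field) path_comb set" where
  "path_algebra Q = {x. {r. x r \<noteq> 0} \<subseteq> paths Q \<and> finite {r. x r \<noteq> 0}}"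

text \<open>
  Paths are multiplied like functions: \<open>p \<cdot> q\<close> is "first \<open>q\<close>, then \<open>p\<close>", and zero if they
  are not composable. With this convention, an arrow \<open>u \<rightarrow> v\<close> maps \<open>e\<^sub>u M\<close> to \<open>e\<^sub>v M\<close> in a left
  module \<open>M\<close>, so that left modules are the (covariant) representations of the quiver.
\<close>

definition pa_mult ::
  "('a, 'b, 'k::field) path_comb \<Rightarrow> ('a, 'b, 'k) path_comb \<Rightarrow> ('a, 'b, 'k) path_comb" where
  "pa_mult x y = (\<lambda>(u, r, v).
     \<Sum>((w, p, v'), (u', q, w')) \<in>
        {((w, p, v'), (u', q, w')). x (w, p, v') \<noteq> 0 \<and> y (u', q, w') \<noteq> 0 \<and>
            w = w' \<and> u' = u \<and> v' = v \<and> r = q @ p}.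
       x (w, p, v') * y (u', q, w'))"

definition pa_one :: "('a, 'b) pre_digraph \<Rightarrow> ('a, 'b, 'k::field) path_comb" where
  "pa_one Q = (\<lambda>(u, p, v). if u \<in> verts Q \<and> p = [] \<and> u = v then 1 else 0)"

definition fscale :: "'k::field \<Rightarrow> ('i \<Rightarrow> 'k) \<Rightarrow> ('i \<Rightarrow> 'k)" where
  "fscale c v = (\<lambda>i. c * v i)"

interpretation fun_vs: vector_space fscale
  by unfold_locales (auto simp: fscale_def algebra_simps fun_eq_iff)

section \<open>Finite-dimensional modules over a path algebra\<close>

text \<open>
  The underlying vector space of a module is a finite-dimensional subspace of the space of all
  sequences in the ground field; up to isomorphism, every finite-dimensional module has this form.
\<close>

record ('a, 'b, 'k) pmod =
  mcarrier :: "(nat \<Rightarrow> 'k) set"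
  mact :: "('a, 'b, 'k) path_comb \<Rightarrow> (nat \<Rightarrow> 'k) \<Rightarrow> (nat \<Rightarrow> 'k)"

definition is_mod :: "('a, 'b) pre_digraph \<Rightarrow> ('a, 'b, 'k::field) pmod \<Rightarrow> bool" where
  "is_mod Q M \<longleftrightarrow>
     fun_vs.subspace (mcarrier M) \<and> (\<exists>B. finite B \<and> fun_vs.span B = mcarrier M) \<and>
     (\<forall>x\<in>path_algebra Q. \<forall>v\<in>mcarrier M. mact M x v \<in> mcarrier M) \<and>
     (\<forall>x\<in>path_algebra Q. \<forall>v\<in>mcarrier M. \<forall>w\<in>mcarrier M.
        mact M x (v + w) = mact M x v + mact M x w) \<and>
     (\<forall>x\<in>path_algebra Q. \<forall>y\<in>path_algebra Q. \<forall>v\<in>mcarrier M.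
        mact M (x + y) v = mact M x v + mact M y v) \<and>
     (\<forall>x\<in>path_algebra Q. \<forall>y\<in>path_algebra Q. \<forall>v\<in>mcarrier M.
        mact M (pa_mult x y) v = mact M x (mact M y v)) \<and>
     (\<forall>c. \<forall>x\<in>path_algebra Q. \<forall>v\<in>mcarrier M. mact M (fscale c x) v = fscale c (mact M x v)) \<and>
     (\<forall>v\<in>mcarrier M. mact M (pa_one Q) v = v)"

definition Hom ::
  "('a, 'b) pre_digraph \<Rightarrow> ('a, 'b, 'k::field) pmod \<Rightarrow> ('a, 'b, 'k) pmod \<Rightarrow>
     ((nat \<Rightarrow> 'k) \<Rightarrow> (nat \<Rightarrow> 'k)) set" where
  "Hom Q M N = {f.
     f ` mcarrier M \<subseteq> mcarrier N \<and>
     (\<forall>v\<in>mcarrier M. \<forall>w\<in>mcarrier M. f (v + w) = f v + f w) \<and>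
     (\<forall>x\<in>path_algebra Q. \<forall>v\<in>mcarrier M. f (mact M x v) = mact N x (f v))}"

definition mod_iso ::
  "('a, 'b) pre_digraph \<Rightarrow> ('a, 'b, 'k::field) pmod \<Rightarrow> ('a, 'b, 'k) pmod \<Rightarrow> bool" where
  "mod_iso Q M N \<longleftrightarrow> (\<exists>f\<in>Hom Q M N. bij_betw f (mcarrier M) (mcarrier N))"

definition iso_class ::
  "('a, 'b) pre_digraph \<Rightarrow> ('a, 'b, 'k::field) pmod \<Rightarrow> ('a, 'b, 'k) pmod set" where
  "iso_class Q M = {N. is_mod Q N \<and> mod_iso Q M N}"

definition submod ::
  "('a, 'b) pre_digraph \<Rightarrow> ('a, 'b, 'k::field) pmod \<Rightarrow> (nat \<Rightarrow> 'k) set \<Rightarrow> bool" where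
  "submod Q M U \<longleftrightarrow> U \<subseteq> mcarrier M \<and> fun_vs.subspace U \<and>
     (\<forall>x\<in>path_algebra Q. \<forall>v\<in>U. mact M x v \<in> U)"

definition restr_mod ::
  "('a, 'b, 'k) pmod \<Rightarrow> (nat \<Rightarrow> 'k) set \<Rightarrow> ('a, 'b, 'k) pmod" where
  "restr_mod M U = M\<lparr>mcarrier := U\<rparr>"

definition simple_mod :: "('a, 'b) pre_digraph \<Rightarrow> ('a, 'b, 'k::field) pmod \<Rightarrow> bool" where
  "simple_mod Q M \<longleftrightarrow> is_mod Q M \<and> mcarrier M \<noteq> {0} \<and>
     (\<forall>U. submod Q M U \<longrightarrow> U = {0} \<or> U = mcarrier M)"

definition indecomposable_mod :: "('a, 'b) pre_digraph \<Rightarrow> ('a, 'b, 'k::field) pmod \<Rightarrow> bool" where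
  "indecomposable_mod Q M \<longleftrightarrow> is_mod Q M \<and> mcarrier M \<noteq> {0} \<and>
     (\<forall>U W. submod Q M U \<and> submod Q M W \<and> U \<inter> W = {0} \<and>
        {u + w |u w. u \<in> U \<and> w \<in> W} = mcarrier M \<longrightarrow> U = {0} \<or> W = {0})"

definition socle ::
  "('a, 'b) pre_digraph \<Rightarrow> ('a, 'b, 'k::field) pmod \<Rightarrow> ('a, 'b, 'k) pmod" where
  "socle Q M = restr_mod M
     (fun_vs.span (\<Union>{U. submod Q M U \<and> simple_mod Q (restr_mod M U)}))"

text \<open>\<open>W / U\<close> is isomorphic to \<open>X\<close>, for submodules \<open>U \<subseteq> W\<close> of \<open>M\<close>: there is a
  surjective homomorphism from \<open>W\<close> to \<open>X\<close> with kernel \<open>U\<close>.\<close>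

definition factor_iso ::
  "('a, 'b) pre_digraph \<Rightarrow> ('a, 'b, 'k::field) pmod \<Rightarrow> (nat \<Rightarrow> 'k) set \<Rightarrow> (nat \<Rightarrow> 'k) set \<Rightarrow>
     ('a, 'b, 'k) pmod \<Rightarrow> bool" where
  "factor_iso Q M U W X \<longleftrightarrow>
     (\<exists>f\<in>Hom Q (restr_mod M W) X. f ` W = mcarrier X \<and> {v\<in>W. f v = 0} = U)"

definition filtration_with_factors ::
  "('a, 'b) pre_digraph \<Rightarrow> ('a, 'b, 'k::field) pmod \<Rightarrow> nat \<Rightarrow> (nat \<Rightarrow> ('a, 'b, 'k) pmod) \<Rightarrow> bool"
where
  "filtration_with_factors Q M t F \<longleftrightarrow>
     (\<exists>U. U 0 = {0} \<and> U t = mcarrier M \<and> (\<forall>i\<le>t. submod Q M (U i)) \<and>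
        (\<forall>i<t. factor_iso Q M (U i) (U (Suc i)) (F i)))"

section \<open>Antichains\<close>

definition brick :: "('a, 'b) pre_digraph \<Rightarrow> ('a, 'b, 'k::field) pmod \<Rightarrow> bool" where
  "brick Q M \<longleftrightarrow> is_mod Q M \<and> mcarrier M \<noteq> {0} \<and>
     (\<forall>f\<in>Hom Q M M. (\<exists>v\<in>mcarrier M. f v \<noteq> 0) \<longrightarrow>
        (\<exists>g\<in>Hom Q M M. \<forall>v\<in>mcarrier M. g (f v) = v \<and> f (g v) = v))"

definition Hom_zero ::
  "('a, 'b) pre_digraph \<Rightarrow> ('a, 'b, 'k::field) pmod \<Rightarrow> ('a, 'b, 'k) pmod \<Rightarrow> bool" where
  "Hom_zero Q M N \<longleftrightarrow> (\<forall>f\<in>Hom Q M N. \<forall>v\<in>mcarrier M. f v = 0)"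

text \<open>\<open>Ext\<^sup>1(M, N) \<noteq> 0\<close>: there is a non-split short exact sequence \<open>0 \<rightarrow> N \<rightarrow> E \<rightarrow> M \<rightarrow> 0\<close>.\<close>

definition Ext1_nonzero ::
  "('a, 'b) pre_digraph \<Rightarrow> ('a, 'b, 'k::field) pmod \<Rightarrow> ('a, 'b, 'k) pmod \<Rightarrow> bool" where
  "Ext1_nonzero Q M N \<longleftrightarrow>
     (\<exists>E. is_mod Q E \<and>
        (\<exists>f\<in>Hom Q N E. \<exists>g\<in>Hom Q E M.
           inj_on f (mcarrier N) \<and> g ` mcarrier E = mcarrier M \<and>
           f ` mcarrier N = {v\<in>mcarrier E. g v = 0} \<and>
           \<not> (\<exists>s\<in>Hom Q M E. \<forall>v\<in>mcarrier M. g (s v) = v)))"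

text \<open>Modules are taken up to isomorphism, so the elements of an antichain are isomorphism classes.\<close>

definition antichain :: "('a, 'b) pre_digraph \<Rightarrow> ('a, 'b, 'k::field) pmod set set \<Rightarrow> bool" where
  "antichain Q A \<longleftrightarrow>
     (\<forall>X\<in>A. \<exists>M. brick Q M \<and> X = iso_class Q M) \<and>
     (\<forall>X\<in>A. \<forall>Y\<in>A. X \<noteq> Y \<longrightarrow> (\<forall>M\<in>X. \<forall>N\<in>Y. Hom_zero Q M N \<and> Hom_zero Q N M))"

definition ext_quiver ::
  "('a, 'b) pre_digraph \<Rightarrow> ('a, 'b, 'k::field) pmod set set \<Rightarrow>
     (('a, 'b, 'k) pmod set \<times> ('a, 'b, 'k) pmod set) set" where
  "ext_quiver Q A = {(X, Y). X \<in> A \<and> Y \<in> A \<and> (\<exists>M\<in>X. \<exists>N\<in>Y. Ext1_nonzero Q M N)}"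

definition exceptional_antichains ::
  "('a, 'b) pre_digraph \<Rightarrow> ('a, 'b, 'k::field) pmod set set set" where
  "exceptional_antichains Q = {A. antichain Q A \<and> acyclic (ext_quiver Q A)}"

definition antichain_order ::
  "('a, 'b) pre_digraph \<Rightarrow>
     (('a, 'b, 'k::field) pmod set set \<times> ('a, 'b, 'k) pmod set set) set" where
  "antichain_order Q = {(A, A').
     A \<in> exceptional_antichains Q \<and> A' \<in> exceptional_antichains Q \<and>
     (\<forall>X\<in>A. \<forall>M\<in>X. \<exists>t F. (\<forall>i<t. F i \<in> \<Union>A') \<and> filtration_with_factors Q M t F)}"

section \<open>The quiver \<open>1 \<leftarrow> 2 \<leftarrow> \<dots> \<leftarrow> n\<close>\<close>

text \<open>The arrow named \<open>i\<close> is \<open>i + 1 \<rightarrow> i\<close>.\<close>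

definition linear_quiver :: "nat \<Rightarrow> (nat, nat) pre_digraph" where
  "linear_quiver n = \<lparr>verts = {1..n}, arcs = {1..<n}, tail = Suc, head = (\<lambda>i. i)\<rparr>"

text \<open>\<open>S(i)\<close> is one-dimensional, and an element of the path algebra acts on it by its coefficient
  at the trivial path at \<open>i\<close>.\<close>

definition simple_at :: "'a \<Rightarrow> ('a, 'b, 'k::field) pmod" where
  "simple_at i = \<lparr>mcarrier = {v. \<forall>j\<noteq>0. v j = 0}, mact = (\<lambda>x v. fscale (x (i, [], i)) v)\<rparr>"

text \<open>
  The class of all indecomposable modules with composition factors \<open>S(a), \<dots>, S(b - 1)\<close>, each
  occurring once, and with socle \<open>S(a)\<close>; for \<open>1 \<le> a < b \<le> n + 1\<close> it is one isomorphism class.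
\<close>

definition interval_class :: "nat \<Rightarrow> nat \<Rightarrow> nat \<Rightarrow> (nat, nat, 'k::field) pmod set" where
  "interval_class n a b = {M.
     indecomposable_mod (linear_quiver n) M \<and>
     (\<exists>\<sigma>. bij_betw \<sigma> {..<b - a} {a..<b} \<and>
        filtration_with_factors (linear_quiver n) M (b - a) (\<lambda>i. simple_at (\<sigma> i))) \<and>
     mod_iso (linear_quiver n) (socle (linear_quiver n) M) (simple_at a)}"

definition arc_antichain :: "nat \<Rightarrow> nat set set \<Rightarrow> (nat, nat, 'k::field) pmod set set" where
  "arc_antichain n P = {interval_class n a b |a b. is_arc P a b}"

end

theory Submission
  imports Defs
begin

text \<open>
  Write \<open>[a, b]\<close> for an explicit model with basis vectors at the vertices \<open>a, \<dots>, b - 1\<close>. Every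
  non-zero module \<open>M\<close> has some \<open>[a, b]\<close> as a direct summand: take the least vertex \<open>a\<close> at which \<open>M\<close> is
  non-zero, the largest \<open>b\<close> such that the path from \<open>b - 1\<close> to \<open>a\<close> acts non-trivially, and split off the
  submodule generated by a vector witnessing this. Hence bricks and indecomposables are the \<open>[a, b]\<close>.
  Since \<open>Hom([a, b], [c, d]) \<noteq> 0\<close> iff \<open>a \<le> c < b \<le> d\<close>, an antichain is the same as a set of pairs
  in which this never happens for distinct pairs, and these are exactly the sets of arcs of
  non-crossing partitions, whose blocks are the connected components. As \<open>[a, b]\<close> is uniserial, it has
  a filtration with factors among the \<open>[c, d]\<close>, \<open>(c, d) \<in> R\<close>, iff \<open>b\<close> can be reached from \<open>a\<close> along \<open>R\<close>,
  which for the arcs \<open>R\<close> of a partition means that \<open>a\<close> and \<open>b\<close> lie in the same block.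
\<close>

section \<open>The path algebra of the linear quiver\<close>

text \<open>Acyclicity of the Ext-quiver is automatic: an extension of \<open>[c, d]\<close> by
  \<open>[a, b]\<close> can be non-split only if a < c, so left ends strictly decrease along its
  arrows. A summand \<open>[a, b]\<close> splits off because any coordinate of the ambient sequence
  space at which the witness is non-zero is a linear functional, and preceding it by the paths to
  \<open>a\<close> gives a retraction; this single splitting replaces a Krull-Schmidt decomposition.
  \<open>interval_class\<close> is described by composition factors and socle, not by a model. It is
  matched with the model through the set of vertices at which a module is non-zero: this set is
  invariant under isomorphism, is the union over the factors of a filtration, and determines an
  interval. The order axioms for antichains are never verified on modules: the map is onto and
  preserves and reflects the relation, so these axioms, and injectivity as well, are carried over
  from \<open>Nc_order\<close>.\<close>

definition pth :: "nat \<Rightarrow> nat \<Rightarrow> nat \<times> nat list \<times> nat" where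
  "pth u i = (u, rev [i..<u], i)"

definition pelem :: "nat \<Rightarrow> nat \<Rightarrow> (nat, nat, 'k::field) path_comb" where
  "pelem u i = (\<lambda>r. if r = pth u i then 1 else 0)"

text \<open>The general element of the left ideal generated by the idempotent at \<open>k\<close>:
  the path from \<open>k\<close> to \<open>i\<close> gets the coefficient \<open>c i\<close>.
  Applied to a generator at the vertex \<open>k\<close>, it produces the vector with coordinates
  \<open>c\<close>.\<close>

definition col :: "nat \<Rightarrow> nat \<Rightarrow> (nat \<Rightarrow> 'k::field) \<Rightarrow> (nat, nat, 'k) path_comb" where
  "col n k c = (\<lambda>r. if r \<in> paths (linear_quiver n) \<and> fst r = k then c (snd (snd r)) else 0)"

abbreviation PA :: "nat \<Rightarrow> (nat, nat, 'k::field) path_comb set" where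
  "PA n \<equiv> path_algebra (linear_quiver n)"

lemma pth_inject [simp]: "pth u i = pth u' i' \<longleftrightarrow> u = u' \<and> i = i'"
  by (auto simp: pth_def)

text \<open>The arrow \<open>e\<close> runs from \<open>e + 1\<close> to \<open>e\<close>, so every
  step of a walk is forced to lower the vertex by one; between two vertices there is at most one
  path.\<close>

lemma cas_linear:
  assumes "pre_digraph.cas (linear_quiver n) u p v"
  shows "v \<le> u \<and> p = rev [v..<u]"
  using assms
proof (induction p arbitrary: u)
  case Nil
  then show ?case by (simp add: pre_digraph.cas.simps)
next
  case (Cons e p)
  then have "u = Suc e" "pre_digraph.cas (linear_quiver n) e p v"
    by (auto simp: pre_digraph.cas.simps linear_quiver_def)
  with Cons.IH[of e] show ?case by auto
qed

lemma cas_linear_rev: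
  "i \<le> u \<Longrightarrow> pre_digraph.cas (linear_quiver n) u (rev [i..<u]) i"
proof (induction u)
  case 0
  then show ?case by (simp add: pre_digraph.cas.simps)
next
  case (Suc u)
  then show ?case
    by (cases "i = Suc u") (auto simp: pre_digraph.cas.simps linear_quiver_def)
qed

lemma paths_linear: "paths (linear_quiver n) = {pth u i |u i. 1 \<le> i \<and> i \<le> u \<and> u \<le> n}"
proof (intro set_eqI iffI)
  fix r assume "r \<in> paths (linear_quiver n)"
  then obtain u p v where r: "r = (u, p, v)" "u \<in> {1..n}" "set p \<subseteq> {1..<n}"
    "pre_digraph.cas (linear_quiver n) u p v"
    by (auto simp: paths_def pre_digraph.awalk_def linear_quiver_def)
  from cas_linear[OF r(4)] have p: "v \<le> u" "p = rev [v..<u]" by auto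
  have "1 \<le> v"
    using p r(2,3) by (cases "v = u") auto
  then show "r \<in> {pth u i |u i. 1 \<le> i \<and> i \<le> u \<and> u \<le> n}"
    using p r by (auto simp: pth_def)
next
  fix r assume "r \<in> {pth u i |u i. 1 \<le> i \<and> i \<le> u \<and> u \<le> n}"
  then show "r \<in> paths (linear_quiver n)"
    using cas_linear_rev by (auto simp: paths_def pre_digraph.awalk_def pth_def linear_quiver_def)
qed

lemma pth_in_paths [simp]: "pth u i \<in> paths (linear_quiver n) \<longleftrightarrow> 1 \<le> i \<and> i \<le> u \<and> u \<le> n"
  by (auto simp: paths_linear)

lemma finite_paths_linear: "finite (paths (linear_quiver n))"
proof -
  have "paths (linear_quiver n) \<subseteq> case_prod pth ` ({1..n} \<times> {1..n})"
    unfolding paths_linear by (force simp del: pth_inject)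
  then show ?thesis by (rule finite_subset) auto
qed

lemma PA_iff: "x \<in> PA n \<longleftrightarrow> (\<forall>r. x r \<noteq> 0 \<longrightarrow> r \<in> paths (linear_quiver n))"
  unfolding path_algebra_def using finite_subset[OF _ finite_paths_linear, of "{r. x r \<noteq> 0}" n]
  by blast

lemma PA_nonzero: "x \<in> PA n \<Longrightarrow> x (pth u i) \<noteq> 0 \<Longrightarrow> 1 \<le> i \<and> i \<le> u \<and> u \<le> n"
  by (metis PA_iff pth_in_paths)

lemma PA_eqI:
  assumes "x \<in> PA n" "y \<in> PA n" "\<And>u i. 1 \<le> i \<Longrightarrow> i \<le> u \<Longrightarrow> u \<le> n \<Longrightarrow> x (pth u i) = y (pth u i)"
  shows "x = y"
proof
  fix r show "x r = y r"
  proof (cases "r \<in> paths (linear_quiver n)")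
    case True
    then show ?thesis using assms(3) unfolding paths_linear by blast
  next
    case False
    then have "x r = 0" "y r = 0" using assms(1,2) unfolding PA_iff by blast+
    then show ?thesis by simp
  qed
qed

lemma PA_closed [simp]:
  "0 \<in> PA n"
  "x \<in> PA n \<Longrightarrow> y \<in> PA n \<Longrightarrow> x + y \<in> PA n"
  "x \<in> PA n \<Longrightarrow> fscale c x \<in> PA n"
  "col n k d \<in> PA n"
proof -
  show "x + y \<in> PA n" if "x \<in> PA n" "y \<in> PA n"
    using that unfolding PA_iff plus_fun_def by (metis add.right_neutral)
qed (simp_all add: PA_iff fscale_def col_def)

lemma pelem_in_PA [simp]: "1 \<le> i \<Longrightarrow> i \<le> u \<Longrightarrow> u \<le> n \<Longrightarrow> pelem u i \<in> PA n"
  by (simp add: PA_iff pelem_def)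

lemma pelem_pth [simp]: "pelem u i (pth u' i') = (if u' = u \<and> i' = i then 1 else 0)"
  by (simp add: pelem_def)

lemma col_pth [simp]:
  "col n k c (pth u i) = (if u = k \<and> 1 \<le> i \<and> i \<le> u \<and> u \<le> n then c i else 0)"
  by (auto simp: col_def pth_def[of u i, symmetric] simp del: One_nat_def) (simp_all add: pth_def)

lemma pa_one_in_PA: "pa_one (linear_quiver n) \<in> PA n"
  and pa_one_pth: "pa_one (linear_quiver n) (pth u i) = (if u = i \<and> 1 \<le> u \<and> u \<le> n then 1 else 0)"
proof -
  show "pa_one (linear_quiver n) \<in> PA n"
    unfolding PA_iff
    by (auto simp: pa_one_def linear_quiver_def paths_def pre_digraph.awalk_def
        pre_digraph.cas.simps split: if_splits)
  show "pa_one (linear_quiver n) (pth u i) = (if u = i \<and> 1 \<le> u \<and> u \<le> n then 1 else 0)"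
    by (auto simp: pa_one_def linear_quiver_def pth_def)
qed

text \<open>Reduces statements that are linear in the algebra element to single paths. The induction
  runs over a finite set containing the support, from which one path is removed at a time.\<close>

lemma PA_induct [consumes 1, case_names zero step]:
  assumes x: "x \<in> PA n"
    and zero: "P 0"
    and step: "\<And>x u i c. x \<in> PA n \<Longrightarrow> P x \<Longrightarrow> 1 \<le> i \<Longrightarrow> i \<le> u \<Longrightarrow> u \<le> n \<Longrightarrow>
      P (x + fscale c (pelem u i))"
  shows "P x"
proof -
  have "finite S \<Longrightarrow> (\<And>x. x \<in> PA n \<Longrightarrow> {r. x r \<noteq> 0} \<subseteq> S \<Longrightarrow> P x)" for S
  proof (induction S rule: finite_induct)
    case empty
    then have "x = 0" by (intro ext) auto
    then show ?case using zero by (simp only:)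
  next
    case (insert r S)
    show ?case
    proof (cases "r \<in> paths (linear_quiver n)")
      case True
      then obtain u i where r: "r = pth u i" "1 \<le> i" "i \<le> u" "u \<le> n" by (auto simp: paths_linear)
      define y where "y = x(r := 0)"
      have y: "y \<in> PA n" "{r. y r \<noteq> 0} \<subseteq> S"
        using insert.prems by (auto simp: PA_iff y_def)
      have "x = y + fscale (x r) (pelem u i)"
        by (auto simp: fun_eq_iff y_def fscale_def pelem_def r)
      with step[OF y(1) insert.IH[OF y] r(2-4)] show ?thesis by metis
    next
      case False
      with insert.prems have "x r = 0" unfolding PA_iff by blast
      with insert.prems have "{r. x r \<noteq> 0} \<subseteq> S" by auto
      then show ?thesis using insert by blast
    qed
  qed
  moreover have "{r. x r \<noteq> 0} \<subseteq> paths (linear_quiver n)" using x unfolding PA_iff by blast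
  ultimately show ?thesis using finite_paths_linear x by blast
qed

lemma pa_mult_nonzero:
  assumes x: "x \<in> PA n" and y: "y \<in> PA n"
    and "x (w, p, v) \<noteq> 0" "y (u, q, w) \<noteq> 0"
  shows "\<exists>i. 1 \<le> i \<and> i \<le> w \<and> w \<le> u \<and> u \<le> n \<and> v = i \<and> (w, p, v) = pth w i \<and> (u, q, w) = pth u w
     \<and> (u, q @ p, v) = pth u i"
proof -
  have "(w, p, v) \<in> paths (linear_quiver n)" "(u, q, w) \<in> paths (linear_quiver n)"
    using assms by (auto simp: PA_iff)
  then have *: "1 \<le> v" "v \<le> w" "w \<le> u" "u \<le> n" "p = rev [v..<w]" "q = rev [w..<u]"
    by (auto simp: paths_linear pth_def)
  have "[v..<u] = [v..<w] @ [w..<u]"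
    using * by (metis le_add_diff_inverse upt_add_eq_append)
  with * show ?thesis by (auto simp: pth_def)
qed

lemma pa_mult_in_PA:
  assumes "x \<in> PA n" "y \<in> PA n"
  shows "pa_mult x y \<in> PA n"
  unfolding PA_iff
proof (intro allI impI)
  fix r assume nz: "pa_mult x y r \<noteq> 0"
  obtain u l v where r: "r = (u, l, v)" by (cases r)
  have "{((w, p, v'), (u', q, w')). x (w, p, v') \<noteq> 0 \<and> y (u', q, w') \<noteq> 0 \<and>
            w = w' \<and> u' = u \<and> v' = v \<and> l = q @ p} \<noteq> {}" (is "?S \<noteq> {}")
  proof
    assume "?S = {}"
    then have "pa_mult x y r = 0" unfolding r pa_mult_def by (simp only: prod.case sum.empty)
    with nz show False by contradiction
  qed
  then obtain w p q where "x (w, p, v) \<noteq> 0" "y (u, q, w) \<noteq> 0" "l = q @ p" by auto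
  from pa_mult_nonzero[OF assms this(1,2)] this(3) show "r \<in> paths (linear_quiver n)"
    by (auto simp: r)
qed

text \<open>A path is determined by its ends, so a factorisation of \<open>pth u i\<close> is
  determined by the middle vertex: the product is that of triangular matrices.\<close>

lemma pa_mult_pth:
  assumes x: "x \<in> PA n" and y: "y \<in> PA n"
  shows "pa_mult x y (pth u i) = (\<Sum>w\<in>{1..n}. x (pth w i) * y (pth u w))"
proof -
  define S where "S = {((w, p, v'), (u', q, w')). x (w, p, v') \<noteq> 0 \<and> y (u', q, w') \<noteq> 0 \<and>
            w = w' \<and> u' = u \<and> v' = i \<and> rev [i..<u] = q @ p}"
  define W where "W = {w \<in> {1..n}. x (pth w i) * y (pth u w) \<noteq> 0}"
  have S: "S = (\<lambda>w. (pth w i, pth u w)) ` W"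
  proof (intro set_eqI iffI)
    fix s assume "s \<in> S"
    then obtain w p q where s: "s = ((w, p, i), (u, q, w))" "x (w, p, i) \<noteq> 0" "y (u, q, w) \<noteq> 0"
      by (auto simp: S_def)
    from pa_mult_nonzero[OF x y s(2,3)] have "(w, p, i) = pth w i" "(u, q, w) = pth u w"
      "1 \<le> w" "w \<le> n" by auto
    with s show "s \<in> (\<lambda>w. (pth w i, pth u w)) ` W" by (auto simp: W_def)
  next
    fix s assume "s \<in> (\<lambda>w. (pth w i, pth u w)) ` W"
    then obtain w where w: "s = (pth w i, pth u w)" "x (pth w i) \<noteq> 0" "y (pth u w) \<noteq> 0"
      by (auto simp: W_def)
    from pa_mult_nonzero[OF x y w(2,3)[unfolded pth_def]] w
    show "s \<in> S" by (auto simp: S_def pth_def)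
  qed
  have inj: "inj_on (\<lambda>w. (pth w i, pth u w)) W" by (auto simp: inj_on_def)
  have "pa_mult x y (pth u i) = (\<Sum>((w, p, v'), (u', q, w'))\<in>S. x (w, p, v') * y (u', q, w'))"
    by (simp add: pa_mult_def pth_def S_def)
  also have "\<dots> = (\<Sum>w\<in>W. x (pth w i) * y (pth u w))"
    unfolding S sum.reindex[OF inj] by (simp add: pth_def)
  also have "\<dots> = (\<Sum>w\<in>{1..n}. x (pth w i) * y (pth u w))"
    by (rule sum.mono_neutral_left) (auto simp: W_def)
  finally show ?thesis .
qed

lemma pelem_mult:
  assumes "1 \<le> i" "i \<le> j" "j \<le> n" "1 \<le> w" "w \<le> u" "u \<le> n"
  shows "pa_mult (pelem j i) (pelem u w) = (if j = w then pelem u i else (0 :: (nat, nat, 'k::field) path_comb))"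
proof (rule PA_eqI[of _ n])
  show "pa_mult (pelem j i) (pelem u w) \<in> PA n" using assms by (intro pa_mult_in_PA) auto
  show "(if j = w then pelem u i else (0 :: (nat, nat, 'k) path_comb)) \<in> PA n" using assms by auto
  fix u' i'
  have "pa_mult (pelem j i) (pelem u w) (pth u' i') =
    (\<Sum>k\<in>{1..n}. pelem j i (pth k i') * pelem u w (pth u' k) :: 'k)"
    by (rule pa_mult_pth) (use assms in auto)
  also have "\<dots> = (\<Sum>k\<in>{1..n}. if k = j then (if j = w \<and> i' = i \<and> u' = u then 1 else 0) else 0)"
    by (rule sum.cong) auto
  also have "\<dots> = (if j = w then pelem u i else (0 :: (nat, nat, 'k) path_comb)) (pth u' i')"
    using assms by (subst sum.delta) auto
  finally show "pa_mult (pelem j i) (pelem u w) (pth u' i') =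
    (if j = w then pelem u i else (0 :: (nat, nat, 'k) path_comb)) (pth u' i')" .
qed

section \<open>Modules and homomorphisms\<close>

lemma pa_one_in_path_algebra:
  "finite (verts Q) \<Longrightarrow> (pa_one Q :: ('a, 'b, 'k::field) path_comb) \<in> path_algebra Q"
proof -
  assume fin: "finite (verts Q)"
  have "{r. pa_one Q r \<noteq> (0 :: 'k)} \<subseteq> (\<lambda>u. (u, [], u)) ` verts Q"
    by (auto simp: pa_one_def split: if_splits)
  moreover have "(\<lambda>u. (u, [], u)) ` verts Q \<subseteq> paths Q"
    by (auto simp: paths_def pre_digraph.awalk_def pre_digraph.cas.simps)
  ultimately show ?thesis
    unfolding path_algebra_def using finite_subset[OF _ finite_imageI[OF fin]] by (simp only: mem_Collect_eq) blast
qed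

lemma
  assumes "is_mod Q M"
  shows mod_zero: "0 \<in> mcarrier M"
    and mod_add: "v \<in> mcarrier M \<Longrightarrow> w \<in> mcarrier M \<Longrightarrow> v + w \<in> mcarrier M"
    and mod_diff: "v \<in> mcarrier M \<Longrightarrow> w \<in> mcarrier M \<Longrightarrow> v - w \<in> mcarrier M"
    and mod_scale: "v \<in> mcarrier M \<Longrightarrow> fscale c v \<in> mcarrier M"
    and mact_closed: "x \<in> path_algebra Q \<Longrightarrow> v \<in> mcarrier M \<Longrightarrow> mact M x v \<in> mcarrier M"
    and mact_add_right: "x \<in> path_algebra Q \<Longrightarrow> v \<in> mcarrier M \<Longrightarrow> w \<in> mcarrier M \<Longrightarrow>
      mact M x (v + w) = mact M x v + mact M x w"
    and mact_add_left: "x \<in> path_algebra Q \<Longrightarrow> y \<in> path_algebra Q \<Longrightarrow> v \<in> mcarrier M \<Longrightarrow>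
      mact M (x + y) v = mact M x v + mact M y v"
    and mact_mult: "x \<in> path_algebra Q \<Longrightarrow> y \<in> path_algebra Q \<Longrightarrow> v \<in> mcarrier M \<Longrightarrow>
      mact M (pa_mult x y) v = mact M x (mact M y v)"
    and mact_scale_left: "x \<in> path_algebra Q \<Longrightarrow> v \<in> mcarrier M \<Longrightarrow>
      mact M (fscale c x) v = fscale c (mact M x v)"
    and mact_one: "v \<in> mcarrier M \<Longrightarrow> mact M (pa_one Q) v = v"
  using assms unfolding is_mod_def
  by (simp_all add: fun_vs.subspace_0 fun_vs.subspace_add fun_vs.subspace_diff fun_vs.subspace_scale)

lemma mact_zero_left: "is_mod Q M \<Longrightarrow> v \<in> mcarrier M \<Longrightarrow> mact M 0 v = 0"
  using mact_add_left[of Q M 0 0 v] by (simp add: path_algebra_def)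

lemma mact_zero_right: "is_mod Q M \<Longrightarrow> x \<in> path_algebra Q \<Longrightarrow> mact M x 0 = 0"
  using mact_add_right[of Q M x 0 0] by (simp add: mod_zero)

text \<open>Linearity over the ground field follows from linearity over the path algebra through
  the scalar multiples of the identity.\<close>

lemma mact_fscale_one:
  assumes "is_mod Q M" "finite (verts Q)" "v \<in> mcarrier M"
  shows "mact M (fscale c (pa_one Q)) v = fscale c v"
  using assms by (simp add: mact_scale_left mact_one pa_one_in_path_algebra)

lemma fscale_in_path_algebra: "x \<in> path_algebra Q \<Longrightarrow> fscale c x \<in> path_algebra Q"
proof -
  assume x: "x \<in> path_algebra Q"
  have "{r. fscale c x r \<noteq> 0} \<subseteq> {r. x r \<noteq> 0}" by (auto simp: fscale_def)
  then show ?thesis using x finite_subset unfolding path_algebra_def by (simp only: mem_Collect_eq) blast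
qed

lemma
  assumes "f \<in> Hom Q M N"
  shows hom_closed: "v \<in> mcarrier M \<Longrightarrow> f v \<in> mcarrier N"
    and hom_add: "v \<in> mcarrier M \<Longrightarrow> w \<in> mcarrier M \<Longrightarrow> f (v + w) = f v + f w"
    and hom_act: "x \<in> path_algebra Q \<Longrightarrow> v \<in> mcarrier M \<Longrightarrow> f (mact M x v) = mact N x (f v)"
  using assms by (auto simp: Hom_def)

lemma hom_0: "f \<in> Hom Q M N \<Longrightarrow> 0 \<in> mcarrier M \<Longrightarrow> f 0 = 0"
  using hom_add[of f Q M N 0 0] by simp

lemma hom_scale:
  assumes "f \<in> Hom Q M N" "is_mod Q M" "is_mod Q N" "finite (verts Q)" "v \<in> mcarrier M"
  shows "f (fscale c v) = fscale c (f v)"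
proof -
  have "f (fscale c v) = f (mact M (fscale c (pa_one Q)) v)"
    using assms by (simp add: mact_fscale_one)
  also have "\<dots> = mact N (fscale c (pa_one Q)) (f v)"
    using assms by (intro hom_act) (auto intro: fscale_in_path_algebra pa_one_in_path_algebra)
  finally show ?thesis using assms by (simp add: mact_fscale_one hom_closed)
qed

lemma hom_diff:
  assumes "f \<in> Hom Q M N" "is_mod Q M" "v \<in> mcarrier M" "w \<in> mcarrier M"
  shows "f (v - w) = f v - f w"
  using hom_add[OF assms(1), of "v - w" w] assms by (simp add: mod_diff)

lemma hom_comp: "f \<in> Hom Q M N \<Longrightarrow> g \<in> Hom Q N L \<Longrightarrow> (\<lambda>v. g (f v)) \<in> Hom Q M L"
  unfolding Hom_def by (auto simp: image_subset_iff)

lemma hom_id: "(\<lambda>v. v) \<in> Hom Q M M"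
  unfolding Hom_def by auto

lemma hom_inverse:
  assumes f: "f \<in> Hom Q M N" and bij: "bij_betw f (mcarrier M) (mcarrier N)" and M: "is_mod Q M"
  shows "inv_into (mcarrier M) f \<in> Hom Q N M"
    and "bij_betw (inv_into (mcarrier M) f) (mcarrier N) (mcarrier M)"
proof -
  let ?g = "inv_into (mcarrier M) f"
  show b: "bij_betw ?g (mcarrier N) (mcarrier M)" by (rule bij_betw_inv_into[OF bij])
  have g: "?g v \<in> mcarrier M" "f (?g v) = v" if "v \<in> mcarrier N" for v
    using that b bij by (auto simp: bij_betw_inv_into_right dest: bij_betwE)
  have gf: "?g w = u" if "u \<in> mcarrier M" "f u = w" for u w
    using bij_betw_inv_into_left[OF bij that(1)] that(2) by simp
  show "?g \<in> Hom Q N M"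
    unfolding Hom_def
    by (auto intro!: gf g simp: hom_add[OF f] hom_act[OF f] g mod_add[OF M] mact_closed[OF M])
qed

lemma mod_iso_refl: "mod_iso Q M M"
  unfolding mod_iso_def by (rule bexI[OF _ hom_id]) (simp add: bij_betw_def)

lemma mod_iso_sym: "is_mod Q M \<Longrightarrow> mod_iso Q M N \<Longrightarrow> mod_iso Q N M"
  unfolding mod_iso_def using hom_inverse by blast

lemma mod_iso_trans:
  assumes "mod_iso Q M N" "mod_iso Q N L"
  shows "mod_iso Q M L"
proof -
  obtain f g where "f \<in> Hom Q M N" "bij_betw f (mcarrier M) (mcarrier N)"
    "g \<in> Hom Q N L" "bij_betw g (mcarrier N) (mcarrier L)"
    using assms unfolding mod_iso_def by blast
  then have "(\<lambda>v. g (f v)) \<in> Hom Q M L" "bij_betw (\<lambda>v. g (f v)) (mcarrier M) (mcarrier L)"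
    using hom_comp bij_betw_trans[unfolded comp_def] by fast+
  then show ?thesis unfolding mod_iso_def by blast
qed

lemma iso_class_eq:
  assumes "is_mod Q M" "is_mod Q N" "mod_iso Q M N"
  shows "iso_class Q M = iso_class Q N"
proof -
  have "mod_iso Q M L \<longleftrightarrow> mod_iso Q N L" for L
    using mod_iso_trans[OF assms(3)] mod_iso_trans[OF mod_iso_sym[OF assms(1,3)]] by metis
  then show ?thesis by (simp add: iso_class_def)
qed

lemma mod_isoI:
  assumes f: "f \<in> Hom Q M N" and g: "g \<in> Hom Q N M"
    and "\<And>v. v \<in> mcarrier M \<Longrightarrow> g (f v) = v" "\<And>v. v \<in> mcarrier N \<Longrightarrow> f (g v) = v"
  shows "mod_iso Q M N"
proof -
  have "bij_betw f (mcarrier M) (mcarrier N)"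
    by (rule bij_betw_byWitness[of _ g]) (auto simp: assms hom_closed[OF f] hom_closed[OF g])
  then show ?thesis using f by (auto simp: mod_iso_def)
qed

lemma submod_subspace: "submod Q M U \<Longrightarrow> fun_vs.subspace U"
  by (simp add: submod_def)

lemma submod_act: "submod Q M U \<Longrightarrow> x \<in> path_algebra Q \<Longrightarrow> v \<in> U \<Longrightarrow> mact M x v \<in> U"
  by (simp add: submod_def)

lemma submod_carrier: "submod Q M U \<Longrightarrow> v \<in> U \<Longrightarrow> v \<in> mcarrier M"
  by (auto simp: submod_def)

lemma restr_mod_simps [simp]: "mcarrier (restr_mod M U) = U" "mact (restr_mod M U) = mact M"
  by (simp_all add: restr_mod_def)

text \<open>The only axiom that needs an argument is finite dimension: a maximal independent subset
  of \<open>U\<close> lies in the span of the finite set \<open>B\<close>, so it is finite.\<close>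

lemma is_mod_restr:
  assumes M: "is_mod Q M" and U: "submod Q M U"
  shows "is_mod Q (restr_mod M U)"
proof -
  obtain B where B: "finite B" "fun_vs.span B = mcarrier M" using M by (auto simp: is_mod_def)
  obtain C where C: "C \<subseteq> U" "fun_vs.independent C" "U \<subseteq> fun_vs.span C"
    using fun_vs.maximal_independent_subset[of U] by blast
  have UM: "U \<subseteq> mcarrier M" using U by (simp add: submod_def)
  have "C \<subseteq> fun_vs.span B" using C(1) UM unfolding B(2) by blast
  then have "finite C" using fun_vs.independent_span_bound[OF B(1) C(2)] by blast
  moreover have "fun_vs.span C = U"
    using fun_vs.span_minimal[OF C(1) submod_subspace[OF U]] C(3) by (rule subset_antisym)
  ultimately have "\<exists>B. finite B \<and> fun_vs.span B = U" by blast
  then show ?thesis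
    unfolding is_mod_def[of Q "restr_mod M U"] restr_mod_simps using UM
    by (intro conjI ballI allI)
      (simp_all add: submod_subspace[OF U] submod_act[OF U] mact_add_right[OF M] mact_add_left[OF M]
        mact_mult[OF M] mact_scale_left[OF M] mact_one[OF M] subsetD)
qed

section \<open>Interval modules\<close>

text \<open>Coordinate \<open>i\<close> of a vector is its component at the vertex \<open>i\<close>.
  A path between two vertices of the interval acts as the identity of the field, and a path that
  leaves the interval acts as zero.\<close>

definition interval_mod :: "nat \<Rightarrow> nat \<Rightarrow> (nat, nat, 'k::field) pmod" where
  "interval_mod a b = \<lparr>mcarrier = {v. \<forall>i. i \<notin> {a..<b} \<longrightarrow> v i = 0},
     mact = (\<lambda>x v i. if i \<in> {a..<b} then \<Sum>u\<in>{a..<b}. x (pth u i) * v u else 0)\<rparr>"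

definition evec :: "nat \<Rightarrow> nat \<Rightarrow> 'k::field" where
  "evec i = (\<lambda>j. if j = i then 1 else 0)"

lemma evec_apply [simp]: "evec i j = (if j = i then 1 else 0)"
  by (simp add: evec_def)

lemma fscale_apply [simp]: "fscale c v i = c * v i"
  by (simp add: fscale_def)

lemma finite_verts_linear [simp]: "finite (verts (linear_quiver n))"
  by (simp add: linear_quiver_def)

lemma interval_carrier: "v \<in> mcarrier (interval_mod a b) \<longleftrightarrow> (\<forall>i. i \<notin> {a..<b} \<longrightarrow> v i = 0)"
  by (simp add: interval_mod_def)

lemma interval_carrierD: "v \<in> mcarrier (interval_mod a b) \<Longrightarrow> \<not> (a \<le> i \<and> i < b) \<Longrightarrow> v i = 0"
  by (simp add: interval_carrier)

lemma interval_act: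
  "mact (interval_mod a b) x v i = (if i \<in> {a..<b} then \<Sum>u\<in>{a..<b}. x (pth u i) * v u else 0)"
  by (simp add: interval_mod_def)

lemma sum_fun_apply: "(\<Sum>s\<in>S. f s) x = (\<Sum>s\<in>S. f s x)"
  by (induction S rule: infinite_finite_induct) auto

lemma interval_mod_is_mod:
  assumes a: "1 \<le> a" and b: "b \<le> n + 1"
  shows "is_mod (linear_quiver n) (interval_mod a b :: (nat, nat, 'k::field) pmod)"
proof -
  let ?I = "interval_mod a b :: (nat, nat, 'k) pmod"
  have sub: "fun_vs.subspace (mcarrier ?I)"
    unfolding fun_vs.subspace_def by (simp add: interval_carrier)
  have "fun_vs.span (evec ` {a..<b}) = mcarrier ?I"
  proof (rule subset_antisym)
    show "fun_vs.span (evec ` {a..<b}) \<subseteq> mcarrier ?I"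
      by (rule fun_vs.span_minimal[OF _ sub]) (auto simp: interval_carrier)
    show "mcarrier ?I \<subseteq> fun_vs.span (evec ` {a..<b})"
    proof
      fix v assume v: "v \<in> mcarrier ?I"
      have "v = (\<Sum>i\<in>{a..<b}. fscale (v i) (evec i))"
      proof
        fix j
        have "(\<Sum>i\<in>{a..<b}. fscale (v i) (evec i)) j = (\<Sum>i\<in>{a..<b}. if j = i then v i else 0)"
          unfolding sum_fun_apply by (rule sum.cong) auto
        also have "\<dots> = v j" using interval_carrierD[OF v, of j] by (subst sum.delta') auto
        finally show "v j = (\<Sum>i\<in>{a..<b}. fscale (v i) (evec i)) j" ..
      qed
      then show "v \<in> fun_vs.span (evec ` {a..<b})"
        by (rule ssubst) (intro fun_vs.span_sum fun_vs.span_scale fun_vs.span_base imageI)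
    qed
  qed
  then have fin: "\<exists>B. finite B \<and> fun_vs.span B = mcarrier ?I" by blast
  have mult: "mact ?I (pa_mult x y) v = mact ?I x (mact ?I y v)"
    if x: "x \<in> PA n" and y: "y \<in> PA n" for x y v
  proof
    fix i
    show "mact ?I (pa_mult x y) v i = mact ?I x (mact ?I y v) i"
    proof (cases "i \<in> {a..<b}")
      case True
      \<comment> \<open>Convexity of the interval: a non-zero term requires i \<le> w \<le> u, so
        the middle vertex never leaves \<open>{a..<b}\<close>.\<close>
      have *: "pa_mult x y (pth u i) = (\<Sum>w\<in>{a..<b}. x (pth w i) * y (pth u w))" if "u \<in> {a..<b}" for u
        unfolding pa_mult_pth[OF x y]
      proof (rule sum.mono_neutral_right)
        show "\<forall>w\<in>{1..n} - {a..<b}. x (pth w i) * y (pth u w) = 0"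
          using PA_nonzero[OF x, of _ i] PA_nonzero[OF y, of u] True that by fastforce
      qed (use a b in auto)
      have "mact ?I (pa_mult x y) v i =
        (\<Sum>u\<in>{a..<b}. \<Sum>w\<in>{a..<b}. x (pth w i) * (y (pth u w) * v u))"
        using True by (simp add: interval_act * sum_distrib_right mult.assoc)
      also have "\<dots> = (\<Sum>w\<in>{a..<b}. \<Sum>u\<in>{a..<b}. x (pth w i) * (y (pth u w) * v u))"
        by (rule sum.swap)
      also have "\<dots> = mact ?I x (mact ?I y v) i"
        using True by (simp add: interval_act sum_distrib_left)
      finally show ?thesis .
    qed (simp add: interval_act del: atLeastLessThan_iff)
  qed
  have one: "mact ?I (pa_one (linear_quiver n)) v = v" if v: "v \<in> mcarrier ?I" for v
  proof
    fix i
    show "mact ?I (pa_one (linear_quiver n)) v i = v i"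
    proof (cases "i \<in> {a..<b}")
      case True
      have "mact ?I (pa_one (linear_quiver n)) v i = (\<Sum>u\<in>{a..<b}. if u = i then v u else 0)"
        unfolding interval_act if_P[OF True] using a b by (intro sum.cong) (auto simp: pa_one_pth)
      also have "\<dots> = v i" using True by (subst sum.delta) auto
      finally show ?thesis .
    qed (use interval_carrierD[OF v, of i] in \<open>auto simp: interval_act\<close>)
  qed
  show ?thesis
    unfolding is_mod_def
    by (intro conjI ballI allI sub fin mult one)
      (simp_all add: interval_carrier interval_act fun_eq_iff distrib_left distrib_right sum.distrib
        sum_distrib_left mult.assoc)
qed

lemma interval_act_pelem:
  "mact (interval_mod a b) (pelem u w) v =
    (if w \<in> {a..<b} \<and> u \<in> {a..<b} then fscale (v u) (evec w) else 0)"
proof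
  fix i
  have "(\<Sum>k\<in>{a..<b}. pelem u w (pth k i) * v k) = (\<Sum>k\<in>{a..<b}. if k = u then if i = w then v u else 0 else 0)"
    by (rule sum.cong) auto
  also have "\<dots> = (if u \<in> {a..<b} \<and> i = w then v u else 0)"
    by (subst sum.delta) auto
  finally show "mact (interval_mod a b) (pelem u w) v i =
    (if w \<in> {a..<b} \<and> u \<in> {a..<b} then fscale (v u) (evec w) else 0) i"
    by (auto simp: interval_act)
qed

lemma interval_act_col:
  assumes "1 \<le> a" "b \<le> n + 1"
  shows "mact (interval_mod a b) (col n k c) v =
    (\<lambda>i. if i \<in> {a..<b} \<and> k \<in> {a..<b} \<and> i \<le> k then c i * v k else 0)"
proof
  fix i
  have "(\<Sum>u\<in>{a..<b}. col n k c (pth u i) * v u) =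
      (\<Sum>u\<in>{a..<b}. if u = k then if i \<le> k then c i * v k else 0 else 0)" if "i \<in> {a..<b}"
    using assms that by (intro sum.cong) auto
  then show "mact (interval_mod a b) (col n k c) v i =
    (if i \<in> {a..<b} \<and> k \<in> {a..<b} \<and> i \<le> k then c i * v k else 0)"
    by (auto simp: interval_act sum.delta)
qed

lemma HomI_pelem:
  assumes M: "is_mod (linear_quiver n) M" and N: "is_mod (linear_quiver n) N"
    and closed: "\<And>v. v \<in> mcarrier M \<Longrightarrow> f v \<in> mcarrier N"
    and add: "\<And>v w. v \<in> mcarrier M \<Longrightarrow> w \<in> mcarrier M \<Longrightarrow> f (v + w) = f v + f w"
    and scale: "\<And>c v. v \<in> mcarrier M \<Longrightarrow> f (fscale c v) = fscale c (f v)"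
    and comm: "\<And>v u w. v \<in> mcarrier M \<Longrightarrow> 1 \<le> w \<Longrightarrow> w \<le> u \<Longrightarrow> u \<le> n \<Longrightarrow>
      f (mact M (pelem u w) v) = mact N (pelem u w) (f v)"
  shows "f \<in> Hom (linear_quiver n) M N"
proof -
  have f0: "f 0 = 0" using add[OF mod_zero[OF M] mod_zero[OF M]] by simp
  have "f (mact M x v) = mact N x (f v)" if v: "v \<in> mcarrier M" and x: "x \<in> PA n" for x v
    using x
  proof (induction x rule: PA_induct)
    case zero
    show "f (mact M 0 v) = mact N 0 (f v)"
      using v by (simp add: mact_zero_left[OF M] mact_zero_left[OF N] closed f0)
  next
    case (step x u i c)
    then show "f (mact M (x + fscale c (pelem u i)) v) = mact N (x + fscale c (pelem u i)) (f v)"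
      using v
      by (simp add: mact_add_left[OF M] mact_add_left[OF N] mact_scale_left[OF M]
          mact_scale_left[OF N] closed add scale comm mact_closed[OF M] mod_scale[OF M])
  qed
  then show ?thesis unfolding Hom_def using closed add by blast
qed

lemma mact_pelem_pelem:
  assumes M: "is_mod (linear_quiver n) M" and v: "v \<in> mcarrier M"
    and "1 \<le> i" "i \<le> j" "j \<le> n" "1 \<le> w" "w \<le> u" "u \<le> n"
  shows "mact M (pelem j i) (mact M (pelem u w) v) = (if j = w then mact M (pelem u i) v else 0)"
proof -
  have "mact M (pelem j i) (mact M (pelem u w) v) = mact M (pa_mult (pelem j i) (pelem u w)) v"
    using assms by (simp add: mact_mult[OF M])
  then show ?thesis using assms by (simp add: pelem_mult mact_zero_left[OF M])
qed

lemma pa_mult_fscale_one: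
  assumes x: "x \<in> PA n"
  shows "pa_mult x (fscale c (pa_one (linear_quiver n))) = fscale c x"
proof (rule PA_eqI[of _ n])
  fix u w assume *: "1 \<le> w" "w \<le> u" "u \<le> n"
  have "pa_mult x (fscale c (pa_one (linear_quiver n))) (pth u w) =
    (\<Sum>l\<in>{1..n}. x (pth l w) * fscale c (pa_one (linear_quiver n)) (pth u l))"
    by (intro pa_mult_pth x PA_closed pa_one_in_PA)
  also have "\<dots> = (\<Sum>l\<in>{1..n}. if l = u then c * x (pth u w) else 0)"
    by (rule sum.cong) (auto simp: pa_one_pth)
  also have "\<dots> = fscale c x (pth u w)"
    using * by (subst sum.delta) auto
  finally show "pa_mult x (fscale c (pa_one (linear_quiver n))) (pth u w) = fscale c x (pth u w)" .
qed (intro pa_mult_in_PA PA_closed pa_one_in_PA x)+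

text \<open>The module axioms put scalars only into the algebra argument. Writing
  \<open>fscale c v\<close> as the action of \<open>c\<close> times the identity moves the scalar
  there by associativity.\<close>

lemma mact_scale_right:
  assumes M: "is_mod (linear_quiver n) M" and x: "x \<in> PA n" and v: "v \<in> mcarrier M"
  shows "mact M x (fscale c v) = fscale c (mact M x v)"
proof -
  have "mact M x (fscale c v) = mact M x (mact M (fscale c (pa_one (linear_quiver n))) v)"
    using v by (simp add: mact_fscale_one[OF M])
  also have "\<dots> = mact M (fscale c x) v"
    using v x by (simp add: pa_mult_fscale_one[OF x, symmetric] mact_mult[OF M] pa_one_in_PA)
  finally show ?thesis using v x by (simp add: mact_scale_left[OF M])
qed

lemma col_add: "col n k (v + w) = col n k v + col n k w"
  and col_scale: "col n k (fscale c v) = fscale c (col n k v)"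
  and col_zero: "col n k 0 = 0"
  by (rule ext, simp add: col_def)+

lemma col_evec: "1 \<le> i \<Longrightarrow> i \<le> k \<Longrightarrow> k \<le> n \<Longrightarrow> col n k (evec i) = pelem k i"
  by (rule PA_eqI[of _ n]) auto

lemma pelem_mult_col:
  assumes "1 \<le> w" "w \<le> u" "u \<le> n" "k \<le> n"
  shows "pa_mult (pelem u w) (col n k c) = (if u \<le> k then fscale (c u) (pelem k w) else 0)"
proof (rule PA_eqI[of _ n])
  show "pa_mult (pelem u w) (col n k c) \<in> PA n" using assms by (intro pa_mult_in_PA) auto
  show "(if u \<le> k then fscale (c u) (pelem k w) else 0) \<in> PA n" using assms by auto
  fix u' i' assume *: "1 \<le> i'" "i' \<le> u'" "u' \<le> n"
  have "pa_mult (pelem u w) (col n k c) (pth u' i') =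
    (\<Sum>j\<in>{1..n}. pelem u w (pth j i') * col n k c (pth u' j))"
    by (rule pa_mult_pth) (use assms in auto)
  also have "\<dots> = (\<Sum>j\<in>{1..n}. if j = u then (if u \<le> k \<and> i' = w \<and> u' = k then c u else 0) else 0)"
    using assms by (intro sum.cong) auto
  also have "\<dots> = (if u \<le> k then fscale (c u) (pelem k w) else 0) (pth u' i')"
    using assms by (subst sum.delta) auto
  finally show "pa_mult (pelem u w) (col n k c) (pth u' i') =
    (if u \<le> k then fscale (c u) (pelem k w) else 0) (pth u' i')" .
qed

text \<open>The module \<open>[c, j + 1]\<close> is the quotient of the projective module generated at the vertex \<open>j\<close>
  by the submodule that is generated at the vertex \<open>c - 1\<close>; this is its universal property.\<close>

lemma interval_generated_hom:
  fixes M :: "(nat, nat, 'k::field) pmod"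
  assumes M: "is_mod (linear_quiver n) M" and x0: "x0 \<in> mcarrier M"
    and c: "1 \<le> c" "j \<le> n"
    and kill: "\<And>w. 1 \<le> w \<Longrightarrow> w < c \<Longrightarrow> w \<le> j \<Longrightarrow> mact M (pelem j w) x0 = 0"
  shows "(\<lambda>v. mact M (col n j v) x0) \<in> Hom (linear_quiver n) (interval_mod c (Suc j)) M"
proof (rule HomI_pelem)
  show "is_mod (linear_quiver n) (interval_mod c (Suc j) :: (nat, nat, 'k) pmod)"
    using c by (intro interval_mod_is_mod) auto
  fix v :: "nat \<Rightarrow> 'k" and u w assume v: "v \<in> mcarrier (interval_mod c (Suc j))" and uw: "1 \<le> w" "w \<le> u" "u \<le> n"
  have "mact M (pelem u w) (mact M (col n j v) x0) = mact M (pa_mult (pelem u w) (col n j v)) x0"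
    using uw x0 by (simp add: mact_mult[OF M])
  also have "\<dots> = (if u \<le> j then fscale (v u) (mact M (pelem j w) x0) else 0)"
    using uw c x0 by (simp add: pelem_mult_col mact_scale_left[OF M] mact_zero_left[OF M])
  also have "\<dots> = mact M (col n j (mact (interval_mod c (Suc j)) (pelem u w) v)) x0"
  proof (cases "u \<in> {c..<Suc j} \<and> w \<ge> c")
    case True
    then show ?thesis
      using uw c x0 by (simp add: interval_act_pelem col_scale col_evec mact_scale_left[OF M])
  next
    case False
    then have "mact (interval_mod c (Suc j)) (pelem u w) v = 0" by (auto simp: interval_act_pelem)
    \<comment> \<open>Either \<open>u < c\<close>, where \<open>v\<close> has no coordinate, or
      \<open>w < c\<close>, where \<open>kill\<close> applies.\<close>
    moreover have "u \<le> j \<Longrightarrow> fscale (v u) (mact M (pelem j w) x0) = 0"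
      using False uw kill[of w] interval_carrierD[OF v, of u] by (cases "u < c") auto
    ultimately show ?thesis using x0 by (simp add: col_zero mact_zero_left[OF M])
  qed
  finally show "mact M (col n j (mact (interval_mod c (Suc j)) (pelem u w) v)) x0 =
    mact M (pelem u w) (mact M (col n j v) x0)" ..
qed (use x0 in \<open>simp_all add: M mact_closed[OF M] col_add col_scale mact_add_left[OF M] mact_scale_left[OF M]\<close>)

text \<open>Arrows lower the vertex, so the top of \<open>[a, b]\<close> sits at
  \<open>b - 1\<close>, and the basis vector there generates the module.\<close>

lemma interval_generated:
  assumes "1 \<le> a" "a < b" "b \<le> n + 1" "v \<in> mcarrier (interval_mod a b)"
  shows "v = mact (interval_mod a b) (col n (b - 1) v) (evec (b - 1))"
proof
  fix i
  show "v i = mact (interval_mod a b) (col n (b - 1) v) (evec (b - 1)) i"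
    using assms(1-3) interval_carrierD[OF assms(4), of i]
    by (cases "a \<le> i \<and> i < b") (auto simp: interval_act_col[OF assms(1,3)])
qed

lemma evec_in_interval: "a \<le> i \<Longrightarrow> i < b \<Longrightarrow> evec i \<in> mcarrier (interval_mod a b)"
  by (simp add: interval_carrier)

lemma interval_hom_eqI:
  assumes "1 \<le> a" "a < b" "b \<le> n + 1"
    and f: "f \<in> Hom (linear_quiver n) (interval_mod a b) M" and g: "g \<in> Hom (linear_quiver n) (interval_mod a b) M"
    and eq: "f (evec (b - 1)) = g (evec (b - 1))" and v: "v \<in> mcarrier (interval_mod a b)"
  shows "f v = g v"
proof -
  have e: "evec (b - 1) \<in> mcarrier (interval_mod a b)" using assms by (intro evec_in_interval) auto
  have "f (mact (interval_mod a b) (col n (b - 1) v) (evec (b - 1))) =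
    g (mact (interval_mod a b) (col n (b - 1) v) (evec (b - 1)))"
    by (simp only: hom_act[OF f _ e] hom_act[OF g _ e] PA_closed eq)
  then show ?thesis using interval_generated[OF assms(1-3) v] by simp
qed

section \<open>Interval summands, bricks and indecomposable modules\<close>

lemma interval_summand:
  fixes M :: "(nat, nat, 'k::field) pmod"
  assumes M: "is_mod (linear_quiver n) M" and nz: "mcarrier M \<noteq> {0}"
  obtains a b \<iota> \<pi> where "1 \<le> a" "a < b" "b \<le> n + 1"
    "\<iota> \<in> Hom (linear_quiver n) (interval_mod a b) M" "\<pi> \<in> Hom (linear_quiver n) M (interval_mod a b)"
    "\<And>v. v \<in> mcarrier (interval_mod a b) \<Longrightarrow> \<pi> (\<iota> v) = v"
proof -
  define supp where "supp i \<longleftrightarrow> 1 \<le> i \<and> i \<le> n \<and> (\<exists>v\<in>mcarrier M. mact M (pelem i i) v \<noteq> 0)" for i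
  have "\<exists>i. supp i"
  proof (rule ccontr)
    assume no: "\<not> (\<exists>i. supp i)"
    have zero: "mact M x v = 0" if v: "v \<in> mcarrier M" and x: "x \<in> PA n" for x v
      using x
    proof (induction x rule: PA_induct)
      case zero
      show ?case by (rule mact_zero_left[OF M v])
    next
      case (step x u i c)
      \<comment> \<open>A path ending at \<open>i\<close> absorbs the idempotent at
        \<open>i\<close>; if all idempotents act as zero, so does the whole algebra, including its
        identity.\<close>
      have "mact M (pelem u i) v = mact M (pelem i i) (mact M (pelem u i) v)"
        using step v by (simp add: mact_pelem_pelem[OF M])
      also have "\<dots> = 0"
      proof -
        have "mact M (pelem u i) v \<in> mcarrier M" using step v by (intro mact_closed[OF M]) auto
        moreover have "1 \<le> i" "i \<le> n" using step by auto
        ultimately show ?thesis using no unfolding supp_def by blast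
      qed
      finally show "mact M (x + fscale c (pelem u i)) v = 0"
        using step v by (simp add: mact_add_left[OF M] mact_scale_left[OF M] fun_eq_iff)
    qed
    have "v = 0" if "v \<in> mcarrier M" for v
      using zero[OF that pa_one_in_PA] mact_one[OF M that] by simp
    then show False using nz mod_zero[OF M] by blast
  qed
  then obtain a where a: "supp a" "\<And>w. w < a \<Longrightarrow> \<not> supp w"
    using exists_least_iff[of supp] by blast
  define J where "J = {j. a \<le> j \<and> j \<le> n \<and> (\<exists>v\<in>mcarrier M. mact M (pelem j a) v \<noteq> 0)}"
  have "finite J" by (rule finite_subset[of _ "{..n}"]) (auto simp: J_def)
  moreover have "J \<noteq> {}" using a(1) unfolding J_def supp_def by blast
  ultimately obtain j where j: "j \<in> J" "\<And>u. u \<in> J \<Longrightarrow> u \<le> j"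
    using Max_in[of J] Max_ge[of J] by blast
  obtain x0 where x0: "x0 \<in> mcarrier M" "mact M (pelem j a) x0 \<noteq> 0" and aj: "1 \<le> a" "a \<le> j" "j \<le> n"
    using j(1) a(1) unfolding J_def supp_def by blast
  define z where "z = mact M (pelem j a) x0"
  \<comment> \<open>Not a vertex but a position in the ambient sequences: evaluation at
    \<open>k\<close>, divided by \<open>z k\<close>, is the functional behind the retraction
    \<open>\<pi>\<close>.\<close>
  obtain k where k: "z k \<noteq> 0" using x0(2) unfolding z_def fun_eq_iff zero_fun_apply by blast
  let ?I = "interval_mod a (Suc j) :: (nat, nat, 'k) pmod"
  have I: "is_mod (linear_quiver n) ?I" using aj by (intro interval_mod_is_mod) auto
  define \<iota> where "\<iota> = (\<lambda>v. mact M (col n j v) x0)"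
  define \<pi> where "\<pi> = (\<lambda>v i. if i \<in> {a..<Suc j} then mact M (pelem i a) v k / z k else 0)"
  have \<iota>: "\<iota> \<in> Hom (linear_quiver n) ?I M"
    unfolding \<iota>_def
  proof (rule interval_generated_hom[OF M x0(1) aj(1,3)])
    fix w assume w: "1 \<le> w" "w < a" "w \<le> j"
    \<comment> \<open>By minimality of \<open>a\<close>, nothing lives at the vertex
      \<open>w\<close>.\<close>
    have "mact M (pelem j w) x0 = mact M (pelem w w) (mact M (pelem j w) x0)"
      using w aj x0 by (simp add: mact_pelem_pelem[OF M])
    also have "\<dots> = 0"
    proof -
      have "mact M (pelem j w) x0 \<in> mcarrier M" using w aj x0 by (intro mact_closed[OF M]) auto
      moreover have "w \<le> n" using w aj by auto
      ultimately show ?thesis using a(2)[OF w(2)] w(1) unfolding supp_def by blast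
    qed
    finally show "mact M (pelem j w) x0 = 0" .
  qed
  have \<pi>: "\<pi> \<in> Hom (linear_quiver n) M ?I"
  proof (rule HomI_pelem[OF M I])
    fix v assume v: "v \<in> mcarrier M"
    show "\<pi> v \<in> mcarrier ?I" by (auto simp: \<pi>_def interval_carrier)
    show "\<pi> (v + w) = \<pi> v + \<pi> w" if "w \<in> mcarrier M" for w
      using v that aj by (intro ext) (simp add: \<pi>_def mact_add_right[OF M] add_divide_distrib)
    show "\<pi> (fscale c v) = fscale c (\<pi> v)" for c
    proof
      fix i
      have "mact M (pelem i a) (fscale c v) = fscale c (mact M (pelem i a) v)" if "a \<le> i" "i \<le> j"
        using that aj v by (simp add: mact_scale_right[OF M])
      then show "\<pi> (fscale c v) i = fscale c (\<pi> v) i" by (auto simp: \<pi>_def)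
    qed
    fix u w assume uw: "1 \<le> w" "w \<le> u" "u \<le> n"
    show "\<pi> (mact M (pelem u w) v) = mact ?I (pelem u w) (\<pi> v)"
    proof
      fix i
      \<comment> \<open>Maximality of \<open>j\<close>: a path from above the interval must have
        image zero under \<open>\<pi>\<close>, as it acts by zero on
        \<open>[a, j + 1]\<close>.\<close>
      have "mact M (pelem u a) v = 0" if "u > j" "a \<le> w"
        using j(2)[of u] that uw v unfolding J_def by fastforce
      then show "\<pi> (mact M (pelem u w) v) i = mact ?I (pelem u w) (\<pi> v) i"
        using v uw aj by (auto simp: \<pi>_def interval_act_pelem mact_pelem_pelem[OF M])
    qed
  qed
  \<comment> \<open>The vector \<open>\<iota> (evec j)\<close> lives at the vertex \<open>j\<close>
    only, and the path from \<open>j\<close> to \<open>a\<close> sends it to \<open>z\<close>, whose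
    normalised coordinate is 1. Agreement on the generator is enough.\<close>
  have "\<pi> (\<iota> (evec j)) = evec j"
  proof
    fix i
    have "\<iota> (evec j) = mact M (pelem j j) x0" using aj by (simp add: \<iota>_def col_evec)
    then show "\<pi> (\<iota> (evec j)) i = evec j i"
      using aj x0(1) k by (auto simp: \<pi>_def z_def mact_pelem_pelem[OF M])
  qed
  then have "\<pi> (\<iota> v) = v" if "v \<in> mcarrier ?I" for v
    using interval_hom_eqI[OF _ _ _ hom_comp[OF \<iota> \<pi>] hom_id _ that] aj by simp
  then show thesis using that[of a "Suc j" \<iota> \<pi>] \<iota> \<pi> aj by simp
qed

text \<open>The endomorphism \<open>\<iota> \<pi>\<close> is idempotent and non-zero. In a brick it
  is therefore invertible, and an invertible idempotent is the identity.\<close>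

lemma brick_iso_interval:
  assumes "brick (linear_quiver n) M"
  obtains a b where "1 \<le> a" "a < b" "b \<le> n + 1" "mod_iso (linear_quiver n) M (interval_mod a b)"
proof -
  have M: "is_mod (linear_quiver n) M" and nz: "mcarrier M \<noteq> {0}" using assms by (auto simp: brick_def)
  obtain a b \<iota> \<pi> where ab: "1 \<le> a" "a < b" "b \<le> n + 1"
    and \<iota>: "\<iota> \<in> Hom (linear_quiver n) (interval_mod a b) M"
    and \<pi>: "\<pi> \<in> Hom (linear_quiver n) M (interval_mod a b)"
    and id: "\<And>v. v \<in> mcarrier (interval_mod a b) \<Longrightarrow> \<pi> (\<iota> v) = v"
    using interval_summand[OF M nz] by blast
  have e: "evec a \<in> mcarrier (interval_mod a b)" using ab by (intro evec_in_interval) auto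
  have "\<iota> (\<pi> (\<iota> (evec a))) \<noteq> 0"
  proof
    assume "\<iota> (\<pi> (\<iota> (evec a))) = 0"
    then have "\<pi> (\<iota> (evec a)) = \<pi> 0" using id[OF e] by simp
    also have "\<dots> = 0" by (rule hom_0[OF \<pi> mod_zero[OF M]])
    finally have "evec a a = (0 :: 'a)" using id[OF e] by simp
    then show False by simp
  qed
  then obtain g where g: "\<And>v. v \<in> mcarrier M \<Longrightarrow> g (\<iota> (\<pi> v)) = v"
  proof -
    have "(\<lambda>v. \<iota> (\<pi> v)) \<in> Hom (linear_quiver n) M M" by (rule hom_comp[OF \<pi> \<iota>])
    moreover have "\<exists>v\<in>mcarrier M. \<iota> (\<pi> v) \<noteq> 0" using \<open>\<iota> (\<pi> (\<iota> (evec a))) \<noteq> 0\<close> hom_closed[OF \<iota> e] by blast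
    ultimately obtain g where "\<forall>v\<in>mcarrier M. g (\<iota> (\<pi> v)) = v"
      using assms unfolding brick_def by meson
    with that show thesis by blast
  qed
  have "\<iota> (\<pi> v) = v" if v: "v \<in> mcarrier M" for v
  proof -
    have p: "\<pi> v \<in> mcarrier (interval_mod a b)" by (rule hom_closed[OF \<pi> v])
    have "\<iota> (\<pi> v) = g (\<iota> (\<pi> (\<iota> (\<pi> v))))" by (rule g[symmetric]) (rule hom_closed[OF \<iota> p])
    also have "\<dots> = v" using id[OF p] g[OF v] by simp
    finally show ?thesis .
  qed
  then have "mod_iso (linear_quiver n) M (interval_mod a b)"
    using id by (intro mod_isoI[OF \<pi> \<iota>])
  with that ab show thesis by blast
qed

text \<open>The idempotent \<open>f\<close> splits \<open>M\<close> into its fixed vectors and its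
  kernel; the former contain the image of \<open>\<iota>\<close>, which is non-zero, so the kernel
  vanishes.\<close>

lemma indecomposable_iso_interval:
  assumes "indecomposable_mod (linear_quiver n) M"
  obtains a b where "1 \<le> a" "a < b" "b \<le> n + 1" "mod_iso (linear_quiver n) M (interval_mod a b)"
proof -
  have M: "is_mod (linear_quiver n) M" and nz: "mcarrier M \<noteq> {0}"
    and indec: "\<And>U W. submod (linear_quiver n) M U \<Longrightarrow> submod (linear_quiver n) M W \<Longrightarrow> U \<inter> W = {0} \<Longrightarrow>
      {u + w |u w. u \<in> U \<and> w \<in> W} = mcarrier M \<Longrightarrow> U = {0} \<or> W = {0}"
    using assms unfolding indecomposable_mod_def by simp_all
  obtain a b \<iota> \<pi> where ab: "1 \<le> a" "a < b" "b \<le> n + 1"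
    and \<iota>: "\<iota> \<in> Hom (linear_quiver n) (interval_mod a b) M"
    and \<pi>: "\<pi> \<in> Hom (linear_quiver n) M (interval_mod a b)"
    and id: "\<And>v. v \<in> mcarrier (interval_mod a b) \<Longrightarrow> \<pi> (\<iota> v) = v"
    using interval_summand[OF M nz] by blast
  have I: "is_mod (linear_quiver n) (interval_mod a b)" using ab by (intro interval_mod_is_mod)
  define f where "f = (\<lambda>v. \<iota> (\<pi> v))"
  have f: "f \<in> Hom (linear_quiver n) M M" unfolding f_def by (rule hom_comp[OF \<pi> \<iota>])
  have ff: "f (f v) = f v" if "v \<in> mcarrier M" for v
    using id[OF hom_closed[OF \<pi> that]] by (simp add: f_def)
  have f0: "f 0 = 0" by (rule hom_0[OF f mod_zero[OF M]])
  define U where "U = {v \<in> mcarrier M. f v = v}"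
  define W where "W = {v \<in> mcarrier M. f v = 0}"
  have "submod (linear_quiver n) M U" "submod (linear_quiver n) M W"
    unfolding submod_def U_def W_def fun_vs.subspace_def
    by (simp_all add: subset_iff mod_zero[OF M] f0 mod_add[OF M] mod_scale[OF M] mact_closed[OF M]
        hom_add[OF f] hom_act[OF f] hom_scale[OF f M M] mact_zero_right[OF M])
  moreover have "U \<inter> W = {0}" using mod_zero[OF M] f0 by (auto simp: U_def W_def)
  moreover have "{u + w |u w. u \<in> U \<and> w \<in> W} = mcarrier M"
  proof (intro subset_antisym subsetI)
    fix v assume v: "v \<in> mcarrier M"
    have "f v \<in> U" "v - f v \<in> W"
      using v by (simp_all add: U_def W_def ff hom_closed[OF f] mod_diff[OF M] hom_diff[OF f M])
    moreover have "v = f v + (v - f v)" by simp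
    ultimately show "v \<in> {u + w |u w. u \<in> U \<and> w \<in> W}" by blast
  qed (auto simp: U_def W_def mod_add[OF M])
  ultimately have "U = {0} \<or> W = {0}" by (rule indec)
  moreover have "U \<noteq> {0}"
  proof
    assume U: "U = {0}"
    have e: "evec a \<in> mcarrier (interval_mod a b)" using ab by (intro evec_in_interval) auto
    have "\<iota> (evec a) \<in> U" using id[OF e] by (simp add: U_def f_def hom_closed[OF \<iota> e])
    with U have "evec a = \<pi> 0" using id[OF e] by simp
    also have "\<dots> = 0" by (rule hom_0[OF \<pi> mod_zero[OF M]])
    finally have "evec a a = (0 :: 'a)" by simp
    then show False by simp
  qed
  ultimately have W: "W = {0}" by blast
  have "\<iota> (\<pi> v) = v" if v: "v \<in> mcarrier M" for v
  proof -
    have "v - f v \<in> W"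
      using v by (simp add: W_def ff hom_closed[OF f] mod_diff[OF M] hom_diff[OF f M])
    then show ?thesis by (simp add: W f_def)
  qed
  then have "mod_iso (linear_quiver n) M (interval_mod a b)"
    using id by (intro mod_isoI[OF \<pi> \<iota>])
  with that ab show thesis by blast
qed

section \<open>Supports and filtrations\<close>

text \<open>For a vertex \<open>k\<close> of the quiver and a module \<open>M\<close>, this detects
  whether \<open>S(k)\<close> is a composition factor, without counting multiplicities; for
  intervals no more information is needed.\<close>

definition supported :: "nat \<Rightarrow> (nat, nat, 'k::field) pmod \<Rightarrow> bool" where
  "supported k M \<longleftrightarrow> (\<exists>v\<in>mcarrier M. mact M (pelem k k) v \<noteq> 0)"

lemma supported_interval: "supported k (interval_mod a b) \<longleftrightarrow> a \<le> k \<and> k < b"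
proof
  show "supported k (interval_mod a b) \<Longrightarrow> a \<le> k \<and> k < b"
    unfolding supported_def by (auto simp: interval_act_pelem split: if_splits)
  assume k: "a \<le> k \<and> k < b"
  then have "mact (interval_mod a b) (pelem k k) (evec k) k \<noteq> (0 :: 'a)"
    by (simp add: interval_act_pelem)
  then have "mact (interval_mod a b) (pelem k k) (evec k) \<noteq> (0 :: nat \<Rightarrow> 'a)" by auto
  then show "supported k (interval_mod a b :: (nat, nat, 'a) pmod)"
    unfolding supported_def using evec_in_interval[of a k b] k by blast
qed

lemma pelem_trivial: "pelem k k (i, [], i) = (if i = k then 1 else 0)"
  using pelem_pth[of k k i i] by (simp add: pth_def)

lemma supported_simple_at: "supported k (simple_at i) \<longleftrightarrow> k = i"
proof
  show "supported k (simple_at i) \<Longrightarrow> k = i"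
    unfolding supported_def simple_at_def
    by (rule ccontr) (auto simp: pelem_trivial fun_eq_iff)
  assume "k = i"
  moreover have "fscale 1 (evec 0) 0 \<noteq> (0 :: 'a)" by simp
  ultimately show "supported k (simple_at i :: (nat, nat, 'a) pmod)"
    unfolding supported_def simple_at_def
    by (intro bexI[of _ "evec 0"]) (auto simp: pelem_trivial fun_eq_iff)
qed

lemma supported_iso:
  assumes iso: "mod_iso (linear_quiver n) M N" and M: "is_mod (linear_quiver n) M" and k: "1 \<le> k" "k \<le> n"
  shows "supported k M \<longleftrightarrow> supported k N"
proof -
  obtain f where f: "f \<in> Hom (linear_quiver n) M N" and bij: "bij_betw f (mcarrier M) (mcarrier N)"
    using iso by (auto simp: mod_iso_def)
  have inj: "f v = 0 \<longleftrightarrow> v = 0" if "v \<in> mcarrier M" for v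
    using bij_betw_imp_inj_on[OF bij] that mod_zero[OF M] hom_0[OF f mod_zero[OF M]]
    by (metis inj_onD)
  have e: "pelem k k \<in> PA n" using k by simp
  have "(\<exists>v\<in>mcarrier M. mact M (pelem k k) v \<noteq> 0) \<longleftrightarrow> (\<exists>v\<in>mcarrier M. mact N (pelem k k) (f v) \<noteq> 0)"
    using inj[OF mact_closed[OF M e]] hom_act[OF f e] by metis
  also have "\<dots> \<longleftrightarrow> (\<exists>v\<in>mcarrier N. mact N (pelem k k) v \<noteq> 0)"
    unfolding bij_betw_imp_surj_on[OF bij, symmetric] by blast
  finally show ?thesis by (simp add: supported_def)
qed

text \<open>Taking the component at a vertex is exact: \<open>W / U\<close> is non-zero at
  \<open>k\<close> iff some vector of \<open>W\<close> fixed by the idempotent at \<open>k\<close>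
  lies outside \<open>U\<close>.\<close>

lemma supported_factor:
  assumes M: "is_mod (linear_quiver n) M" and W: "submod (linear_quiver n) M W"
    and fac: "factor_iso (linear_quiver n) M U W X" and k: "1 \<le> k" "k \<le> n"
  shows "supported k X \<longleftrightarrow> (\<exists>w\<in>W. w \<notin> U \<and> mact M (pelem k k) w = w)"
proof -
  obtain f where f: "f \<in> Hom (linear_quiver n) (restr_mod M W) X"
    and surj: "f ` W = mcarrier X" and ker: "{v\<in>W. f v = 0} = U"
    using fac by (auto simp: factor_iso_def)
  have e: "pelem k k \<in> PA n" using k by simp
  have fe: "f (mact M (pelem k k) w) = mact X (pelem k k) (f w)" if "w \<in> W" for w
    using hom_act[OF f e] that by simp
  show ?thesis
  proof
    assume "supported k X"
    then obtain x where x: "x \<in> f ` W" "mact X (pelem k k) x \<noteq> 0"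
      unfolding supported_def surj by (elim bexE)
    then obtain w where w: "w \<in> W" "mact X (pelem k k) (f w) \<noteq> 0"
      by (elim imageE) simp
    let ?w = "mact M (pelem k k) w"
    have wM: "w \<in> mcarrier M" using W w(1) by (rule submod_carrier)
    have "?w \<in> W" using submod_act[OF W e w(1)] .
    moreover have "?w \<notin> U" using w fe[OF w(1)] ker by auto
    moreover have "mact M (pelem k k) ?w = ?w"
      using mact_pelem_pelem[OF M wM, of k k k k] k by simp
    ultimately show "\<exists>w\<in>W. w \<notin> U \<and> mact M (pelem k k) w = w" by blast
  next
    assume "\<exists>w\<in>W. w \<notin> U \<and> mact M (pelem k k) w = w"
    then obtain w where w: "w \<in> W" "w \<notin> U" "mact M (pelem k k) w = w" by blast
    have "mact X (pelem k k) (f w) = f w" using fe[OF w(1)] w(3) by simp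
    moreover have "f w \<noteq> 0" using w ker by auto
    moreover have "f w \<in> mcarrier X" using w(1) by (simp add: surj[symmetric])
    ultimately show "supported k X" unfolding supported_def by (intro bexI[of _ "f w"]) simp_all
  qed
qed

lemma supported_filtration:
  assumes M: "is_mod (linear_quiver n) M" and fil: "filtration_with_factors (linear_quiver n) M t F"
    and k: "1 \<le> k" "k \<le> n"
  shows "supported k M \<longleftrightarrow> (\<exists>i<t. supported k (F i))"
proof -
  obtain U where U0: "U 0 = {0}" and Ut: "U t = mcarrier M"
    and sub: "\<And>i. i \<le> t \<Longrightarrow> submod (linear_quiver n) M (U i)"
    and fac: "\<And>i. i < t \<Longrightarrow> factor_iso (linear_quiver n) M (U i) (U (Suc i)) (F i)"
    using fil unfolding filtration_with_factors_def by blast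
  have supp: "supported k (F i) \<longleftrightarrow> (\<exists>w\<in>U (Suc i). w \<notin> U i \<and> mact M (pelem k k) w = w)" if "i < t" for i
    using that by (intro supported_factor[OF M sub fac k]) auto
  show ?thesis
  proof
    assume "supported k M"
    then obtain v where v: "v \<in> mcarrier M" "mact M (pelem k k) v \<noteq> 0" by (auto simp: supported_def)
    define w where "w = mact M (pelem k k) v"
    have w: "w \<in> U t" "mact M (pelem k k) w = w" "w \<notin> U 0"
      using v k mact_closed[OF M] by (auto simp: w_def Ut U0 mact_pelem_pelem[OF M])
    \<comment> \<open>The first layer containing \<open>w\<close>; its index is positive because
      \<open>w\<close> is non-zero.\<close>
    obtain i where i: "i \<le> t" "\<And>j. j < i \<Longrightarrow> w \<notin> U j" "w \<in> U i"
      using w(1) exists_least_iff[of "\<lambda>i. i \<le> t \<and> w \<in> U i"] by fastforce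
    then obtain j where "i = Suc j" using w(3) by (cases i) auto
    with i have "j < t" "w \<in> U (Suc j)" "w \<notin> U j" by auto
    with supp[of j] w(2) show "\<exists>i<t. supported k (F i)" by blast
  next
    assume "\<exists>i<t. supported k (F i)"
    then obtain i w where w: "i < t" "w \<in> U (Suc i)" "w \<notin> U i" "mact M (pelem k k) w = w"
      using supp by blast
    have "0 \<in> U i" using fun_vs.subspace_0[OF submod_subspace[OF sub[of i]]] w(1) by simp
    moreover have "w \<in> mcarrier M" using submod_carrier[OF sub[of "Suc i"] w(2)] w(1) by simp
    ultimately show "supported k M" unfolding supported_def using w(3,4) by (intro bexI[of _ w]) auto
  qed
qed

lemma factor_iso_trans:
  assumes "factor_iso Q M U W X" and iso: "mod_iso Q X Y" and X: "is_mod Q X"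
  shows "factor_iso Q M U W Y"
proof -
  obtain f where f: "f \<in> Hom Q (restr_mod M W) X" "f ` W = mcarrier X" "{v\<in>W. f v = 0} = U"
    using assms(1) by (auto simp: factor_iso_def)
  obtain g where g: "g \<in> Hom Q X Y" and bij: "bij_betw g (mcarrier X) (mcarrier Y)"
    using iso by (auto simp: mod_iso_def)
  have inj: "g v = 0 \<longleftrightarrow> v = 0" if "v \<in> mcarrier X" for v
    using bij_betw_imp_inj_on[OF bij] that mod_zero[OF X] hom_0[OF g mod_zero[OF X]]
    by (metis inj_onD)
  have "(\<lambda>v. g (f v)) ` W = mcarrier Y"
    using f(2) bij_betw_imp_surj_on[OF bij] by (simp add: image_image[symmetric])
  moreover have "f v \<in> mcarrier X" if "v \<in> W" for v using f(2) that by blast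
  then have "{v\<in>W. g (f v) = 0} = U" using inj f(3) by auto
  ultimately show ?thesis
    unfolding factor_iso_def by (intro bexI[OF _ hom_comp[OF f(1) g]]) simp
qed

text \<open>The two one-dimensional models differ only in the position of the entry,
  \<open>i\<close> in one and 0 in the other.\<close>

lemma interval_iso_simple_at: "mod_iso Q (interval_mod i (Suc i)) (simple_at i)"
proof -
  let ?f = "\<lambda>v :: nat \<Rightarrow> 'a. \<lambda>j. if j = 0 then v i else 0"
  let ?g = "\<lambda>v :: nat \<Rightarrow> 'a. \<lambda>j. if j = i then v 0 else 0"
  have *: "{i..<Suc i} = {i}" by auto
  show ?thesis
  proof (rule mod_isoI)
    show "?f \<in> Hom Q (interval_mod i (Suc i)) (simple_at i)"
      unfolding Hom_def by (auto simp: interval_mod_def simple_at_def fun_eq_iff * pth_def)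
    show "?g \<in> Hom Q (simple_at i) (interval_mod i (Suc i))"
      unfolding Hom_def by (auto simp: interval_mod_def simple_at_def fun_eq_iff * pth_def)
  qed (auto simp: interval_carrier simple_at_def fun_eq_iff)
qed

section \<open>Coordinates on modules isomorphic to interval modules\<close>

text \<open>The filtration order and \<open>interval_class\<close> concern all representatives of an
  isomorphism class, so a chosen isomorphism \<open>g\<close> serves as a coordinate system on an
  arbitrary \<open>M\<close>.\<close>

locale interval_coords =
  fixes n a b :: nat and M :: "(nat, nat, 'k::field) pmod" and g :: "(nat \<Rightarrow> 'k) \<Rightarrow> nat \<Rightarrow> 'k"
  assumes ab: "1 \<le> a" "a < b" "b \<le> n + 1"
    and M: "is_mod (linear_quiver n) M"
    and g: "g \<in> Hom (linear_quiver n) M (interval_mod a b)"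
    and bij: "bij_betw g (mcarrier M) (mcarrier (interval_mod a b))"
begin

lemma I: "is_mod (linear_quiver n) (interval_mod a b)"
  using ab by (intro interval_mod_is_mod)

lemma coords_eqI: "v \<in> mcarrier M \<Longrightarrow> w \<in> mcarrier M \<Longrightarrow> g v = g w \<Longrightarrow> v = w"
  using bij_betw_imp_inj_on[OF bij] by (rule inj_onD)

lemma coords_0: "g 0 = 0"
  by (rule hom_0[OF g mod_zero[OF M]])

lemma coords_outside: "v \<in> mcarrier M \<Longrightarrow> \<not> (a \<le> i \<and> i < b) \<Longrightarrow> g v i = 0"
  by (rule interval_carrierD[OF hom_closed[OF g]])

lemma lift: 
  assumes "v \<in> mcarrier (interval_mod a b)" obtains w where "w \<in> mcarrier M" "g w = v"
proof -
  have "v \<in> g ` mcarrier M" using assms bij_betw_imp_surj_on[OF bij] by simp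
  then show thesis by (elim imageE) (simp add: that)
qed

text \<open>For a \<le> y \<le> b this is the submodule \<open>[a, y]\<close> of \<open>M\<close>;
  every submodule turns out to be of this kind.\<close>

definition lower :: "nat \<Rightarrow> (nat \<Rightarrow> 'k) set" where
  "lower y = {v \<in> mcarrier M. \<forall>k\<ge>y. g v k = 0}"

lemma lower_submod: "submod (linear_quiver n) M (lower y)"
proof -
  have "g (mact M x v) k = 0" if x: "x \<in> PA n" and v: "v \<in> mcarrier M" "\<forall>k\<ge>y. g v k = 0" and k: "y \<le> k" for x v k
  proof -
    \<comment> \<open>Paths only lower the vertex: a non-zero coefficient forces k \<le> u, where
      the coordinate of \<open>v\<close> is already zero.\<close>
    have "x (pth u k) * g v u = 0" for u
      using PA_nonzero[OF x, of u k] v(2) k by (cases "u < y") auto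
    then have "(\<Sum>u\<in>{a..<b}. x (pth u k) * g v u) = 0" by (intro sum.neutral ballI)
    then show ?thesis using hom_act[OF g x v(1)] by (simp add: interval_act)
  qed
  then show ?thesis
    unfolding submod_def lower_def fun_vs.subspace_def
    by (simp add: subset_iff mod_zero[OF M] coords_0 mod_add[OF M] mod_scale[OF M] mact_closed[OF M]
        hom_add[OF g] hom_scale[OF g M I])
qed

lemma lower_bottom: "lower a = {0}"
proof -
  have "v = 0" if "v \<in> lower a" for v
  proof (rule coords_eqI)
    show v: "v \<in> mcarrier M" using that by (simp add: lower_def)
    show "g v = g 0"
      unfolding coords_0 using that coords_outside[OF v] by (auto simp: lower_def fun_eq_iff)
  qed (rule mod_zero[OF M])
  moreover have "0 \<in> lower a" by (simp add: lower_def mod_zero[OF M] coords_0)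
  ultimately show ?thesis by blast
qed

lemma lower_top: "lower b = mcarrier M"
  using coords_outside by (auto simp: lower_def)

lemma lower_mono: "y \<le> z \<Longrightarrow> lower y \<subseteq> lower z"
  by (auto simp: lower_def)

text \<open>With the pivot \<open>g u k\<close> inverted, combinations of paths starting at
  \<open>k\<close> turn \<open>u\<close> into any vector with coordinates at most \<open>k\<close>;
  the other coordinates of \<open>u\<close> are ignored by such paths.\<close>

lemma lower_le_submod:
  assumes U: "submod (linear_quiver n) M U" and u: "u \<in> U" and k: "g u k \<noteq> 0"
  shows "lower (Suc k) \<subseteq> U"
proof
  fix v assume v: "v \<in> lower (Suc k)"
  have uM: "u \<in> mcarrier M" using U u by (rule submod_carrier)
  have kab: "a \<le> k" "k < b" using coords_outside[OF uM, of k] k by auto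
  define w where "w = mact M (col n k (\<lambda>i. g v i / g u k)) u"
  have wU: "w \<in> U" unfolding w_def by (intro submod_act[OF U] u) simp
  have vM: "v \<in> mcarrier M" using v by (simp add: lower_def)
  have "g w = mact (interval_mod a b) (col n k (\<lambda>i. g v i / g u k)) (g u)"
    unfolding w_def by (rule hom_act[OF g _ uM]) simp
  also have "\<dots> = g v"
  proof
    fix i
    show "mact (interval_mod a b) (col n k (\<lambda>i. g v i / g u k)) (g u) i = g v i"
      using v k kab coords_outside[OF vM, of i] by (auto simp: interval_act_col[OF ab(1,3)] lower_def)
  qed
  finally have "w = v" using coords_eqI[OF submod_carrier[OF U wU] vM] by simp
  with wU show "v \<in> U" by simp
qed

text \<open>For the least \<open>y\<close> with \<open>U\<close> inside \<open>lower y\<close>, some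
  vector of \<open>U\<close> has a non-zero coordinate at \<open>y - 1\<close> and so generates all
  of \<open>lower y\<close>. The bound a \<le> y is part of the minimisation because
  \<open>lower y\<close> is zero for every y \<le> a.\<close>

lemma uniserial:
  assumes U: "submod (linear_quiver n) M U"
  obtains y where "a \<le> y" "y \<le> b" "U = lower y"
proof -
  have "\<exists>y. a \<le> y \<and> U \<subseteq> lower y"
    using ab lower_top U by (auto simp: submod_def intro!: exI[of _ b])
  then obtain y where y: "a \<le> y" "U \<subseteq> lower y"
    and least: "\<And>z. z < y \<Longrightarrow> \<not> (a \<le> z \<and> U \<subseteq> lower z)"
    using exists_least_iff[of "\<lambda>y. a \<le> y \<and> U \<subseteq> lower y"] by blast
  have "\<not> b < y" using least[of b] ab lower_top U by (auto simp: submod_def)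
  then have "y \<le> b" by simp
  moreover have "lower y \<subseteq> U"
  proof (cases "y = a")
    case True
    then show ?thesis using fun_vs.subspace_0[OF submod_subspace[OF U]] by (simp add: lower_bottom)
  next
    case False
    then obtain z where z: "y = Suc z" "a \<le> z" using y(1) by (cases y) auto
    then have "\<not> U \<subseteq> lower z" using least[of z] by simp
    then obtain u where u: "u \<in> U" "u \<notin> lower z" by blast
    have "g u z \<noteq> 0"
    proof
      assume "g u z = 0"
      then have "g u k = 0" if "k \<ge> z" for k
        using u(1) y(2) that z(1) by (cases "k = z") (auto simp: lower_def)
      then show False using u submod_carrier[OF U u(1)] by (simp add: lower_def)
    qed
    from lower_le_submod[OF U u(1) this] show ?thesis by (simp add: z)
  qed
  ultimately show thesis using that[of y] y by simp
qed

lemma coordinate_vector: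
  assumes "a \<le> k" "k < b"
  obtains w where "w \<in> mcarrier M" "g w = evec k" "mact M (pelem k k) w = w"
proof -
  obtain w where w: "w \<in> mcarrier M" "g w = evec k"
    by (rule lift[OF evec_in_interval[OF assms]])
  have e: "pelem k k \<in> PA n" using assms ab by simp
  have "g (mact M (pelem k k) w) = g w"
    unfolding hom_act[OF g e w(1)] w(2) using assms by (simp add: interval_act_pelem fun_eq_iff)
  then have "mact M (pelem k k) w = w"
    by (rule coords_eqI[OF mact_closed[OF M e w(1)] w(1)])
  then show thesis by (rule that[OF w])
qed

lemma lower_supported:
  assumes fac: "factor_iso (linear_quiver n) M (lower y) (lower z) X" and k: "1 \<le> k" "k \<le> n"
    and yz: "a \<le> y" "z \<le> b"
  shows "supported k X \<longleftrightarrow> y \<le> k \<and> k < z"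
  unfolding supported_factor[OF M lower_submod fac k]
proof
  assume "\<exists>w\<in>lower z. w \<notin> lower y \<and> mact M (pelem k k) w = w"
  then obtain w where w: "w \<in> lower z" "w \<notin> lower y" "mact M (pelem k k) w = w" by blast
  have wM: "w \<in> mcarrier M" using w(1) by (simp add: lower_def)
  have gw: "mact (interval_mod a b) (pelem k k) (g w) = g w"
    using hom_act[OF g _ wM, of "pelem k k"] k w(3) by simp
  have *: "g w i = 0" if "i \<noteq> k" for i
  proof -
    have "g w i = mact (interval_mod a b) (pelem k k) (g w) i" by (simp only: gw)
    also have "\<dots> = 0" using that by (simp add: interval_act_pelem)
    finally show ?thesis .
  qed
  obtain i where "i \<ge> y" "g w i \<noteq> 0" using w(2) wM by (auto simp: lower_def)
  moreover then have "i < z" using w(1) by (auto simp: lower_def not_less[symmetric])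
  ultimately show "y \<le> k \<and> k < z" using * by metis
next
  assume "y \<le> k \<and> k < z"
  moreover then have "a \<le> k" "k < b" using yz by auto
  then obtain w where "w \<in> mcarrier M" "g w = evec k" "mact M (pelem k k) w = w"
    by (rule coordinate_vector)
  ultimately show "\<exists>w\<in>lower z. w \<notin> lower y \<and> mact M (pelem k k) w = w"
    by (intro bexI[of _ w]) (auto simp: lower_def)
qed

text \<open>\<open>[a, d] / [a, c]\<close> is \<open>[c, d]\<close>, by truncation of
  coordinates.\<close>

lemma lower_factor:
  assumes "a \<le> c" "c \<le> d" "d \<le> b"
  shows "factor_iso (linear_quiver n) M (lower c) (lower d) (interval_mod c d)"
proof -
  let ?f = "\<lambda>v i. if i \<in> {c..<d} then g v i else 0"
  have "?f \<in> Hom (linear_quiver n) (restr_mod M (lower d)) (interval_mod c d)"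
  proof -
    have "?f (mact M x v) i = mact (interval_mod c d) x (?f v) i"
      if x: "x \<in> PA n" and v: "v \<in> lower d" for x v i
    proof (cases "i \<in> {c..<d}")
      case True
      have vM: "v \<in> mcarrier M" and v0: "\<And>k. k \<ge> d \<Longrightarrow> g v k = 0" using v by (auto simp: lower_def)
      have "?f (mact M x v) i = (\<Sum>u\<in>{a..<b}. x (pth u i) * g v u)"
        using True assms by (simp add: hom_act[OF g x vM] interval_act)
      also have "\<dots> = (\<Sum>u\<in>{c..<d}. x (pth u i) * g v u)"
      \<comment> \<open>Below \<open>c\<close> there is no path to \<open>i\<close>, and from
        \<open>d\<close> on the coordinates of \<open>v\<close> vanish.\<close>
      proof (rule sum.mono_neutral_right)
        show "\<forall>u\<in>{a..<b} - {c..<d}. x (pth u i) * g v u = 0"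
          using v0 PA_nonzero[OF x, of _ i] True by fastforce
      qed (use assms in auto)
      also have "\<dots> = mact (interval_mod c d) x (?f v) i"
        using True by (simp add: interval_act)
      finally show ?thesis .
    qed (simp add: interval_act del: atLeastLessThan_iff)
    moreover have "?f (v + w) = ?f v + ?f w" if "v \<in> lower d" "w \<in> lower d" for v w
      using that hom_add[OF g, of v w] by (simp add: lower_def fun_eq_iff)
    moreover have "?f v \<in> mcarrier (interval_mod c d)" for v by (simp add: interval_carrier)
    ultimately show ?thesis
      unfolding Hom_def restr_mod_simps image_subset_iff fun_eq_iff by simp
  qed
  moreover have "?f ` lower d = mcarrier (interval_mod c d)"
  proof (intro subset_antisym subsetI)
    fix v :: "nat \<Rightarrow> 'k" assume v: "v \<in> mcarrier (interval_mod c d)"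
    then have "v \<in> mcarrier (interval_mod a b)" using assms by (auto simp: interval_carrier)
    then obtain w where w: "w \<in> mcarrier M" "g w = v" by (rule lift)
    have "w \<in> lower d" using w interval_carrierD[OF v] by (auto simp: lower_def)
    moreover have "?f w = v" using w interval_carrierD[OF v] by (auto simp: fun_eq_iff)
    ultimately show "v \<in> ?f ` lower d" by (intro image_eqI[of _ _ w]) simp_all
  qed (auto simp: interval_carrier)
  moreover have "{v\<in>lower d. ?f v = 0} = lower c"
  proof (intro set_eqI iffI)
    fix v assume "v \<in> lower c"
    then show "v \<in> {v\<in>lower d. ?f v = 0}"
      using assms by (auto simp: lower_def fun_eq_iff)
  next
    fix v assume v: "v \<in> {v\<in>lower d. ?f v = 0}"
    then have fk: "?f v k = 0" for k using fun_cong[of "?f v" 0 k] by simp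
    have "g v k = 0" if "k \<ge> c" for k
      using v that fk[of k] by (cases "k < d") (simp_all add: lower_def)
    then show "v \<in> lower c" using v by (simp add: lower_def)
  qed
  ultimately show ?thesis unfolding factor_iso_def by (intro bexI[of _ ?f] conjI)
qed

lemma lower_nonzero: "a < y \<Longrightarrow> lower y \<noteq> {0}"
proof
  assume y: "a < y" "lower y = {0}"
  obtain w where w: "w \<in> mcarrier M" "g w = evec a" by (rule coordinate_vector[OF order_refl ab(2)])
  then have "w \<in> lower y" using y(1) by (auto simp: lower_def)
  then have "g w a = g 0 a" using y(2) by simp
  then show False using w coords_0 by simp
qed

text \<open>The submodule at the vertex \<open>a\<close> lies in every non-zero submodule. This
  yields both the socle and indecomposability, since two non-zero submodules cannot meet in
  zero.\<close>

lemma socle_le_submod: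
  assumes "submod (linear_quiver n) M U" "U \<noteq> {0}"
  shows "lower (Suc a) \<subseteq> U"
proof -
  obtain y where "a \<le> y" "U = lower y" using uniserial[OF assms(1)] by blast
  with assms(2) lower_bottom show ?thesis by (metis le_neq_implies_less lower_mono Suc_leI)
qed

lemma simple_socle: "simple_mod (linear_quiver n) (restr_mod M (lower (Suc a)))"
  unfolding simple_mod_def restr_mod_simps
proof (intro conjI allI impI)
  show "is_mod (linear_quiver n) (restr_mod M (lower (Suc a)))"
    by (rule is_mod_restr[OF M lower_submod])
  show "lower (Suc a) \<noteq> {0}" by (rule lower_nonzero) simp
  fix U assume U: "submod (linear_quiver n) (restr_mod M (lower (Suc a))) U"
  have "submod (linear_quiver n) M U"
    using U submod_carrier[OF lower_submod[of "Suc a"]] unfolding submod_def restr_mod_simps by blast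
  moreover have "U \<subseteq> lower (Suc a)" using U by (simp add: submod_def)
  ultimately show "U = {0} \<or> U = lower (Suc a)" using socle_le_submod by blast
qed

lemma socle_eq: "socle (linear_quiver n) M = restr_mod M (lower (Suc a))"
proof -
  have "U = lower (Suc a)" if U: "submod (linear_quiver n) M U" "simple_mod (linear_quiver n) (restr_mod M U)" for U
  proof -
    have U0: "U \<noteq> {0}" using U(2) by (simp add: simple_mod_def)
    have le: "lower (Suc a) \<subseteq> U" by (rule socle_le_submod[OF U(1) U0])
    have "submod (linear_quiver n) (restr_mod M U) (lower (Suc a))"
      using le lower_submod[of "Suc a"] unfolding submod_def restr_mod_simps by blast
    then show ?thesis
      using U(2) lower_nonzero[of "Suc a"] unfolding simple_mod_def restr_mod_simps by blast
  qed
  then have "{U. submod (linear_quiver n) M U \<and> simple_mod (linear_quiver n) (restr_mod M U)} = {lower (Suc a)}"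
    using lower_submod simple_socle by blast
  then have "\<Union>{U. submod (linear_quiver n) M U \<and> simple_mod (linear_quiver n) (restr_mod M U)} = lower (Suc a)"
    by simp
  moreover have "fun_vs.span (lower (Suc a)) = lower (Suc a)"
    by (intro fun_vs.span_eq_iff[THEN iffD2] submod_subspace[OF lower_submod])
  ultimately show ?thesis by (simp add: socle_def)
qed

lemma socle_iso: "mod_iso (linear_quiver n) (socle (linear_quiver n) M) (simple_at a)"
proof -
  have "factor_iso (linear_quiver n) M (lower a) (lower (Suc a)) (interval_mod a (Suc a))"
    using ab by (intro lower_factor) auto
  then have "factor_iso (linear_quiver n) M {0} (lower (Suc a)) (simple_at a)"
    unfolding lower_bottom
    using ab by (intro factor_iso_trans[OF _ interval_iso_simple_at] interval_mod_is_mod) auto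
  then obtain f where f: "f \<in> Hom (linear_quiver n) (restr_mod M (lower (Suc a))) (simple_at a)"
    "f ` lower (Suc a) = mcarrier (simple_at a :: (nat, nat, 'k) pmod)" and ker: "{v \<in> lower (Suc a). f v = 0} = {0}"
    unfolding factor_iso_def by (elim bexE conjE) (rule that, assumption+)
  have R: "is_mod (linear_quiver n) (restr_mod M (lower (Suc a)))"
    by (rule is_mod_restr[OF M lower_submod])
  have "inj_on f (lower (Suc a))"
  proof (rule inj_onI)
    fix v w assume vw: "v \<in> lower (Suc a)" "w \<in> lower (Suc a)" "f v = f w"
    then have "v - w \<in> lower (Suc a)" "f (v - w) = 0"
      using mod_diff[OF R, of v w] hom_diff[OF f(1) R, of v w] by simp_all
    then have "v - w = 0" using ker by blast
    then show "v = w" by simp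
  qed
  then show ?thesis
    unfolding mod_iso_def socle_eq restr_mod_simps using f by (intro bexI[of _ f] bij_betw_imageI)
qed

lemma composition_series:
  "filtration_with_factors (linear_quiver n) M (b - a) (\<lambda>i. simple_at (a + i))"
  unfolding filtration_with_factors_def
proof (intro exI[of _ "\<lambda>i. lower (a + i)"] conjI allI impI)
  fix i assume "i < b - a"
  then show "factor_iso (linear_quiver n) M (lower (a + i)) (lower (a + Suc i)) (simple_at (a + i))"
    using ab lower_factor[of "a + i" "a + Suc i"]
    by (intro factor_iso_trans[OF _ interval_iso_simple_at] interval_mod_is_mod) auto
qed (use ab in \<open>simp_all add: lower_bottom lower_top lower_submod\<close>)

lemma indecomposable: "indecomposable_mod (linear_quiver n) M"
proof -
  have nz: "lower (Suc a) \<noteq> {0}" by (rule lower_nonzero) simp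
  then have "mcarrier M \<noteq> {0}" using lower_mono[of "Suc a" b] ab mod_zero[OF M] lower_top
      fun_vs.subspace_0[OF submod_subspace[OF lower_submod[of "Suc a"]]] by auto
  moreover have "U = {0} \<or> W = {0}"
    if "submod (linear_quiver n) M U" "submod (linear_quiver n) M W" "U \<inter> W = {0}" for U W
    using socle_le_submod[OF that(1)] socle_le_submod[OF that(2)] that(3) nz
      fun_vs.subspace_0[OF submod_subspace[OF lower_submod[of "Suc a"]]] by blast
  ultimately show ?thesis unfolding indecomposable_mod_def using M by blast
qed

lemma in_interval_class: "M \<in> interval_class n a b"
proof -
  have "bij_betw (\<lambda>i. a + i) {..<b - a} {a..<b}"
    by (rule bij_betw_byWitness[of _ "\<lambda>i. i - a"]) auto
  then show ?thesis
    unfolding interval_class_def using indecomposable composition_series socle_iso by blast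
qed

end

section \<open>Interval classes as isomorphism classes\<close>

lemma interval_coords_exists:
  assumes "1 \<le> a" "a < b" "b \<le> n + 1" "is_mod (linear_quiver n) M"
    "mod_iso (linear_quiver n) M (interval_mod a b)"
  obtains g where "interval_coords n a b M g"
  using assms by (auto simp: mod_iso_def interval_coords_def)

lemma atLeastLessThan_eqD:
  fixes a b c d :: nat
  assumes "a < b" "c < d" "\<And>k. 1 \<le> k \<Longrightarrow> k \<le> n \<Longrightarrow> a \<le> k \<and> k < b \<longleftrightarrow> c \<le> k \<and> k < d"
    "1 \<le> a" "b \<le> n + 1" "1 \<le> c" "d \<le> n + 1"
  shows "a = c \<and> b = d"
proof -
  have "k \<in> {a..<b} \<longleftrightarrow> k \<in> {c..<d}" for k
    using assms(3)[of k] assms(4-7) by (cases "1 \<le> k \<and> k \<le> n") auto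
  then have "{a..<b} = {c..<d}" by blast
  then show ?thesis using assms by (simp add: atLeastLessThan_eq_iff)
qed

text \<open>An indecomposable module is some \<open>[c, d]\<close>; its composition factors
  determine the vertices at which it is non-zero, and these are \<open>{c..<d}\<close>, so
  \<open>(c, d)\<close> equals \<open>(a, b)\<close>. The converse is read off in
  coordinates.\<close>

lemma interval_class_eq:
  assumes ab: "1 \<le> a" "a < b" "b \<le> n + 1"
  shows "interval_class n a b = iso_class (linear_quiver n) (interval_mod a b :: (nat, nat, 'k::field) pmod)"
proof (intro set_eqI iffI)
  fix M :: "(nat, nat, 'k) pmod"
  assume "M \<in> interval_class n a b"
  then obtain \<sigma> where ind: "indecomposable_mod (linear_quiver n) M" and \<sigma>: "bij_betw \<sigma> {..<b - a} {a..<b}"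
    and fil: "filtration_with_factors (linear_quiver n) M (b - a) (\<lambda>i. simple_at (\<sigma> i))"
    unfolding interval_class_def by blast
  have M: "is_mod (linear_quiver n) M" using ind by (simp add: indecomposable_mod_def)
  obtain c d where cd: "1 \<le> c" "c < d" "d \<le> n + 1" and iso: "mod_iso (linear_quiver n) M (interval_mod c d)"
    using indecomposable_iso_interval[OF ind] by blast
  have "a \<le> k \<and> k < b \<longleftrightarrow> c \<le> k \<and> k < d" if k: "1 \<le> k" "k \<le> n" for k
  proof -
    have "c \<le> k \<and> k < d \<longleftrightarrow> supported k M"
      using supported_iso[OF iso M k] by (simp add: supported_interval)
    also have "\<dots> \<longleftrightarrow> k \<in> \<sigma> ` {..<b - a}"
      using supported_filtration[OF M fil k] by (auto simp: supported_simple_at)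
    also have "\<dots> \<longleftrightarrow> a \<le> k \<and> k < b" using bij_betw_imp_surj_on[OF \<sigma>] by simp
    finally show ?thesis ..
  qed
  then have "a = c" "b = d" using atLeastLessThan_eqD[of a b c d n] ab cd by auto
  with iso M show "M \<in> iso_class (linear_quiver n) (interval_mod a b)"
    by (simp add: iso_class_def mod_iso_sym)
next
  fix M :: "(nat, nat, 'k) pmod"
  assume "M \<in> iso_class (linear_quiver n) (interval_mod a b)"
  then have "is_mod (linear_quiver n) M" "mod_iso (linear_quiver n) M (interval_mod a b)"
    using mod_iso_sym[OF interval_mod_is_mod[OF ab(1,3)]] by (auto simp: iso_class_def)
  then obtain g where "interval_coords n a b M g" using interval_coords_exists[OF ab] by blast
  then show "M \<in> interval_class n a b" by (rule interval_coords.in_interval_class)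
qed

lemma interval_classD:
  assumes "1 \<le> a" "a < b" "b \<le> n + 1" "M \<in> interval_class n a b"
  shows "is_mod (linear_quiver n) M" "mod_iso (linear_quiver n) M (interval_mod a b)"
    "mod_iso (linear_quiver n) (interval_mod a b) M"
  using assms(4) mod_iso_sym[OF interval_mod_is_mod[OF assms(1,3)]]
  unfolding interval_class_eq[OF assms(1-3)] iso_class_def by blast+

lemma interval_mod_in_class:
  "1 \<le> a \<Longrightarrow> a < b \<Longrightarrow> b \<le> n + 1 \<Longrightarrow> interval_mod a b \<in> interval_class n a b"
  by (simp add: interval_class_eq iso_class_def interval_mod_is_mod mod_iso_refl)

lemma supported_interval_class:
  assumes "1 \<le> a" "a < b" "b \<le> n + 1" "M \<in> interval_class n a b" "1 \<le> k" "k \<le> n"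
  shows "supported k M \<longleftrightarrow> a \<le> k \<and> k < b"
  using supported_iso[OF interval_classD(2,1)[OF assms(1-4)] assms(5,6)]
  by (simp add: supported_interval)

lemma interval_class_inject:
  assumes "1 \<le> a" "a < b" "b \<le> n + 1" "1 \<le> c" "c < d" "d \<le> n + 1"
    and M: "M \<in> interval_class n a b" "M \<in> interval_class n c d"
  shows "a = c \<and> b = d"
  using assms supported_interval_class[OF _ _ _ M(1)] supported_interval_class[OF _ _ _ M(2)]
  by (intro atLeastLessThan_eqD[of a b c d n]) auto

text \<open>In a uniserial module all submodules of a filtration have the form \<open>lower y\<close>, so a
  filtration with factors among the modules \<open>[c, d]\<close>, \<open>(c, d) \<in> R\<close>, is a walk along \<open>R\<close>.\<close>

lemma (in interval_coords) filtration_iff_rtrancl: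
  assumes R: "\<And>c d. (c, d) \<in> R \<Longrightarrow> 1 \<le> c \<and> c < d \<and> d \<le> n + 1"
  shows "(\<exists>t F. (\<forall>i<t. F i \<in> \<Union>{interval_class n c d |c d. (c, d) \<in> R}) \<and>
    filtration_with_factors (linear_quiver n) M t F) \<longleftrightarrow> (a, b) \<in> R\<^sup>*"
proof
  assume "\<exists>t F. (\<forall>i<t. F i \<in> \<Union>{interval_class n c d |c d. (c, d) \<in> R}) \<and>
    filtration_with_factors (linear_quiver n) M t F"
  then obtain t F where F': "\<forall>i<t. F i \<in> \<Union>{interval_class n c d |c d. (c, d) \<in> R}"
    and fil: "filtration_with_factors (linear_quiver n) M t F"
    by (elim exE conjE) (rule that)
  have F: "\<exists>c d. (c, d) \<in> R \<and> F i \<in> interval_class n c d" if "i < t" for i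
    using F'[rule_format, OF that] by (elim UnionE CollectE exE conjE) auto
  obtain U where U0: "U 0 = {0}" and Ut: "U t = mcarrier M"
    and Usub: "\<forall>i\<le>t. submod (linear_quiver n) M (U i)"
    and Ufac: "\<forall>i<t. factor_iso (linear_quiver n) M (U i) (U (Suc i)) (F i)"
    using fil unfolding filtration_with_factors_def by (elim exE conjE) (rule that)
  note U = U0 Ut Usub[rule_format] Ufac[rule_format]
  have "\<exists>y. i \<le> t \<longrightarrow> a \<le> y \<and> y \<le> b \<and> U i = lower y" for i
  proof (cases "i \<le> t")
    case True
    obtain y where "a \<le> y" "y \<le> b" "U i = lower y" by (rule uniserial[OF U(3)[OF True]])
    then show ?thesis by (intro exI[of _ y]) simp
  qed simp
  then have "\<forall>i. \<exists>y. i \<le> t \<longrightarrow> a \<le> y \<and> y \<le> b \<and> U i = lower y" ..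
  then obtain y where y': "\<forall>i. i \<le> t \<longrightarrow> a \<le> y i \<and> y i \<le> b \<and> U i = lower (y i)"
    by (rule choice[THEN exE])
  note y = y'[rule_format]
  have step: "(y i, y (Suc i)) \<in> R" if i: "i < t" for i
  proof -
    obtain c d where cd: "(c, d) \<in> R" "F i \<in> interval_class n c d" using F[OF i] by blast
    note cd' = R[OF cd(1)]
    have yi: "a \<le> y i" "y (Suc i) \<le> b" "y i \<le> b" "a \<le> y (Suc i)" using y[of i] y[of "Suc i"] i by auto
    have fac: "factor_iso (linear_quiver n) M (lower (y i)) (lower (y (Suc i))) (F i)"
      using U(4)[OF i] y[of i] y[of "Suc i"] i by simp
    have *: "c \<le> k \<and> k < d \<longleftrightarrow> y i \<le> k \<and> k < y (Suc i)" if "1 \<le> k" "k \<le> n" for k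
      using lower_supported[OF fac that yi(1,2)] supported_interval_class[OF _ _ _ cd(2) that] cd' by simp
    \<comment> \<open>The factor is non-zero at the vertex \<open>c\<close>, so the step is strictly
      increasing and both intervals are non-empty; equal supports then give equal ends.\<close>
    have "y i < y (Suc i)" using *[of c] cd' by auto
    then have "c = y i \<and> d = y (Suc i)"
      using atLeastLessThan_eqD[of c d "y i" "y (Suc i)" n] * cd' yi ab by auto
    with cd(1) show ?thesis by simp
  qed
  have "(y 0, y i) \<in> R\<^sup>*" if "i \<le> t" for i
    using that
  proof (induction i)
    case (Suc i)
    then show ?case using step[of i] by (auto intro: rtrancl_into_rtrancl)
  qed simp
  moreover have "y 0 = a" using y[of 0] U(1) lower_nonzero[of "y 0"] by (cases "y 0 = a") auto
  moreover have "y t = b"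
  proof (rule ccontr)
    assume "y t \<noteq> b"
    with y[of t] have yt: "a \<le> y t" "y t < b" by auto
    obtain w where w: "w \<in> mcarrier M" "g w = evec (y t)" by (rule coordinate_vector[OF yt])
    then have "w \<in> lower (y t)" using U(2) y[of t] by simp
    then show False using w by (auto simp: lower_def)
  qed
  ultimately show "(a, b) \<in> R\<^sup>*" by blast
next
  assume "(a, b) \<in> R\<^sup>*"
  then obtain t where "(a, b) \<in> R ^^ t" using rtrancl_imp_relpow by blast
  then obtain f where f0: "f 0 = a" "f t = b" and fR: "\<forall>i<t. (f i, f (Suc i)) \<in> R"
    unfolding relpow_fun_conv by (elim exE conjE) (rule that)
  note f = f0 fR[rule_format]
  \<comment> \<open>Pairs in \<open>R\<close> increase, so the walk stays between its ends:
    induction from the start bounds it below, induction from the end bounds it above.\<close>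
  have lo: "a \<le> f i" if "i \<le> t" for i
    using that
  proof (induction i)
    case (Suc i)
    then show ?case using R[OF f(3)[of i]] by auto
  qed (simp add: f)
  have hi: "f i \<le> b" if "i \<le> t" for i
    using that
  proof (induction i rule: inc_induct)
    case (step i)
    then show ?case using R[OF f(3)[of i]] by auto
  qed (simp add: f)
  show "\<exists>t F. (\<forall>i<t. F i \<in> \<Union>{interval_class n c d |c d. (c, d) \<in> R}) \<and>
    filtration_with_factors (linear_quiver n) M t F"
  proof (intro exI[of _ t] exI[of _ "\<lambda>i. interval_mod (f i) (f (Suc i))"] conjI allI impI)
    fix i assume "i < t"
    then show "interval_mod (f i) (f (Suc i)) \<in> \<Union>{interval_class n c d |c d. (c, d) \<in> R}"
      using f(3)[of i] R[of "f i" "f (Suc i)"] interval_mod_in_class[of "f i" "f (Suc i)" n] by blast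
  next
    show "filtration_with_factors (linear_quiver n) M t (\<lambda>i. interval_mod (f i) (f (Suc i)))"
      unfolding filtration_with_factors_def
    proof (intro exI[of _ "\<lambda>i. lower (f i)"] conjI allI impI)
      fix i assume i: "i < t"
      show "factor_iso (linear_quiver n) M (lower (f i)) (lower (f (Suc i))) (interval_mod (f i) (f (Suc i)))"
        using i lo[of i] hi[of "Suc i"] R[OF f(3)[OF i]] by (intro lower_factor) auto
    qed (simp_all add: f lower_bottom lower_top lower_submod)
  qed
qed

section \<open>Homomorphisms and extensions between interval modules\<close>

lemma scale_hom:
  assumes M: "is_mod (linear_quiver n) M"
  shows "fscale c \<in> Hom (linear_quiver n) M M"
proof (rule HomI_pelem[OF M M])
  fix v u w assume "v \<in> mcarrier M" "1 \<le> w" "w \<le> u" "u \<le> n"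
  then show "fscale c (mact M (pelem u w) v) = mact M (pelem u w) (fscale c v)"
    by (simp add: mact_scale_right[OF M])
qed (auto simp: mod_scale[OF M] fun_eq_iff distrib_left)

lemma zero_hom:
  assumes M: "is_mod (linear_quiver n) M" and N: "is_mod (linear_quiver n) N"
  shows "(\<lambda>_. 0) \<in> Hom (linear_quiver n) M N"
  by (rule HomI_pelem[OF M N]) (simp_all add: mod_zero[OF N] mact_zero_right[OF N] fun_eq_iff)

lemma Hom_zeroD: "Hom_zero Q M N \<Longrightarrow> f \<in> Hom Q M N \<Longrightarrow> v \<in> mcarrier M \<Longrightarrow> f v = 0"
  unfolding Hom_zero_def by (drule (1) bspec, drule (1) bspec)

text \<open>The generator is fixed by the idempotent at \<open>b - 1\<close>, so its image lies in
  the component of \<open>[c, d]\<close> at that vertex, which has dimension at most one. Every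
  homomorphism is thus given by one scalar.\<close>

lemma interval_hom_generator:
  assumes ab: "1 \<le> a" "a < b" "b \<le> n + 1"
    and f: "f \<in> Hom (linear_quiver n) (interval_mod a b) (interval_mod c d)"
  shows "f (evec (b - 1)) = (if b - 1 \<in> {c..<d} then fscale (f (evec (b - 1)) (b - 1)) (evec (b - 1)) else 0)"
proof -
  have e: "pelem (b - 1) (b - 1) \<in> PA n" using ab by simp
  have "evec (b - 1) \<in> mcarrier (interval_mod a b)" using ab by (intro evec_in_interval) auto
  note f_act = hom_act[OF f e this]
  have gen: "mact (interval_mod a b) (pelem (b - 1) (b - 1)) (evec (b - 1)) = evec (b - 1)"
    using ab by (auto simp: interval_act_pelem fun_eq_iff)
  have "f (evec (b - 1)) = mact (interval_mod c d) (pelem (b - 1) (b - 1)) (f (evec (b - 1)))"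
    using f_act unfolding gen .
  then show ?thesis by (simp only: interval_act_pelem conj_absorb)
qed

text \<open>The image of a non-zero homomorphism is a quotient of \<open>[a, b]\<close> and a submodule of \<open>[c, d]\<close>,
  hence equal to \<open>[c, b]\<close>.\<close>

lemma Hom_zero_interval_iff:
  assumes ab: "1 \<le> a" "a < b" "b \<le> n + 1" and cd: "1 \<le> c" "c < d" "d \<le> n + 1"
  shows "Hom_zero (linear_quiver n) (interval_mod a b :: (nat, nat, 'k::field) pmod) (interval_mod c d)
    \<longleftrightarrow> \<not> (a \<le> c \<and> c < b \<and> b \<le> d)"
proof -
  let ?I = "interval_mod a b :: (nat, nat, 'k) pmod" and ?J = "interval_mod c d :: (nat, nat, 'k) pmod"
  define j where "j = b - 1"
  have j: "b = Suc j" "a \<le> j" "1 \<le> j" "j \<le> n" using ab by (auto simp: j_def)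
  have I: "is_mod (linear_quiver n) ?I" and J: "is_mod (linear_quiver n) ?J"
    using ab cd by (simp_all only: interval_mod_is_mod)
  have ej: "evec j \<in> mcarrier ?I" using j by (intro evec_in_interval) auto
  show ?thesis
  proof
    assume zero: "Hom_zero (linear_quiver n) ?I ?J"
    show "\<not> (a \<le> c \<and> c < b \<and> b \<le> d)"
    proof
      assume *: "a \<le> c \<and> c < b \<and> b \<le> d"
      have "(\<lambda>v. mact ?J (col n j v) (evec j)) \<in> Hom (linear_quiver n) (interval_mod a (Suc j)) ?J"
      proof (rule interval_generated_hom[OF J _ ab(1) j(4)])
        show "evec j \<in> mcarrier ?J" using * j by (intro evec_in_interval) auto
        fix w assume "w < a"
        then show "mact ?J (pelem j w) (evec j) = 0" using * by (simp add: interval_act_pelem)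
      qed
      then have "mact ?J (col n j (evec j)) (evec j) = 0"
        using Hom_zeroD[OF zero[unfolded j(1)] _ ej[unfolded j(1)]] by fast
      moreover have "mact ?J (col n j (evec j)) (evec j) j = 1"
        using * j by (simp add: interval_act_col[OF cd(1,3)])
      ultimately show False by simp
    qed
  next
    assume *: "\<not> (a \<le> c \<and> c < b \<and> b \<le> d)"
    show "Hom_zero (linear_quiver n) ?I ?J"
      unfolding Hom_zero_def
    proof (intro ballI)
      fix f v assume f: "f \<in> Hom (linear_quiver n) ?I ?J" and v: "v \<in> mcarrier ?I"
      have gen: "f (evec j) = (if j \<in> {c..<d} then fscale (f (evec j) j) (evec j) else 0)"
        using interval_hom_generator[OF ab f] by (simp only: j_def)
      have "f (evec j) = 0"
      proof (cases "j \<in> {c..<d}")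
        case True
        then have ca: "c < a" "c \<le> j" using * j by auto
        \<comment> \<open>As \<open>c < a\<close>, the path from \<open>j\<close> to
          \<open>c\<close> kills the generator of \<open>[a, b]\<close> but acts injectively on the
          component of \<open>[c, d]\<close> at \<open>j\<close>, so the scalar vanishes.\<close>
        have "mact ?J (pelem j c) (f (evec j)) = f (mact ?I (pelem j c) (evec j))"
          using ca cd(1) j by (intro hom_act[OF f _ ej, symmetric]) simp
        also have "mact ?I (pelem j c) (evec j) = 0" using ca by (simp add: interval_act_pelem)
        also have "f 0 = 0" by (rule hom_0[OF f mod_zero[OF I]])
        finally have "mact ?J (pelem j c) (f (evec j)) c = 0" by (simp only: zero_fun_apply)
        then have "f (evec j) j = 0" using True cd by (simp add: interval_act_pelem)
        then show ?thesis by (subst gen) (simp add: fun_eq_iff)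
      next
        case False
        then show ?thesis by (subst gen) (simp only: if_False)
      qed
      then show "f v = 0"
        using interval_hom_eqI[OF ab f zero_hom[OF I J] _ v] by (simp add: j_def)
    qed
  qed
qed

text \<open>An endomorphism multiplies the generator by a scalar \<open>t\<close>, hence every
  vector; if it is non-zero, division by \<open>t\<close> is its inverse.\<close>

lemma brick_interval:
  assumes ab: "1 \<le> a" "a < b" "b \<le> n + 1"
  shows "brick (linear_quiver n) (interval_mod a b :: (nat, nat, 'k::field) pmod)"
proof -
  let ?I = "interval_mod a b :: (nat, nat, 'k) pmod"
  have I: "is_mod (linear_quiver n) ?I" using ab by (intro interval_mod_is_mod)
  have "evec a \<in> mcarrier ?I" using ab by (intro evec_in_interval) auto
  moreover have "evec a \<noteq> (0 :: nat \<Rightarrow> 'k)"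
  proof
    assume "evec a = (0 :: nat \<Rightarrow> 'k)"
    then have "evec a a = (0 :: 'k)" by (simp only: zero_fun_apply)
    then show False by simp
  qed
  ultimately have nz: "mcarrier ?I \<noteq> {0}" by auto
  have "\<exists>g\<in>Hom (linear_quiver n) ?I ?I. \<forall>v\<in>mcarrier ?I. g (f v) = v \<and> f (g v) = v"
    if f: "f \<in> Hom (linear_quiver n) ?I ?I" and nonzero: "\<exists>v\<in>mcarrier ?I. f v \<noteq> 0" for f
  proof -
    define t where "t = f (evec (b - 1)) (b - 1)"
    have "b - 1 \<in> {a..<b}" using ab by auto
    then have "f (evec (b - 1)) = fscale t (evec (b - 1))"
      by (subst interval_hom_generator[OF ab f]) (simp only: if_True t_def)
    then have ft: "f v = fscale t v" if "v \<in> mcarrier ?I" for v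
      by (rule interval_hom_eqI[OF ab f scale_hom[OF I] _ that])
    have "t \<noteq> 0"
    proof
      assume "t = 0"
      then have "f v = 0" if "v \<in> mcarrier ?I" for v using ft[OF that] by (simp add: fun_eq_iff)
      with nonzero show False by auto
    qed
    then show ?thesis
      by (intro bexI[OF _ scale_hom[OF I, of "1 / t"]])
        (simp add: ft mod_scale[OF I] fun_eq_iff)
  qed
  then show ?thesis unfolding brick_def using I nz by blast
qed

lemma Hom_zero_iso:
  assumes zero: "Hom_zero (linear_quiver n) M' N'" and M: "is_mod (linear_quiver n) M"
    and N: "is_mod (linear_quiver n) N"
    and iso: "mod_iso (linear_quiver n) M M'" "mod_iso (linear_quiver n) N N'"
  shows "Hom_zero (linear_quiver n) M N"
  unfolding Hom_zero_def
proof (intro ballI)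
  fix h v assume h: "h \<in> Hom (linear_quiver n) M N" and v: "v \<in> mcarrier M"
  obtain f where f: "f \<in> Hom (linear_quiver n) M M'" and bf: "bij_betw f (mcarrier M) (mcarrier M')"
    using iso(1) by (auto simp: mod_iso_def)
  obtain g where g: "g \<in> Hom (linear_quiver n) N N'" and bg: "bij_betw g (mcarrier N) (mcarrier N')"
    using iso(2) by (auto simp: mod_iso_def)
  let ?f = "inv_into (mcarrier M) f"
  have "(\<lambda>w. g (h (?f w))) \<in> Hom (linear_quiver n) M' N'"
    by (intro hom_comp[OF hom_comp[OF hom_inverse(1)[OF f bf M] h] g])
  then have "g (h (?f (f v))) = 0"
    by (rule Hom_zeroD[OF zero _ hom_closed[OF f v]])
  then have "g (h v) = g 0"
    using bij_betw_inv_into_left[OF bf v] hom_0[OF g mod_zero[OF N]] by simp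
  then show "h v = 0"
    using inj_onD[OF bij_betw_imp_inj_on[OF bg] _ hom_closed[OF h v] mod_zero[OF N]] by simp
qed

lemma Hom_zero_interval_class:
  fixes M N :: "(nat, nat, 'k::field) pmod"
  assumes ab: "1 \<le> a" "a < b" "b \<le> n + 1" and cd: "1 \<le> c" "c < d" "d \<le> n + 1"
    and M: "M \<in> interval_class n a b" and N: "N \<in> interval_class n c d"
  shows "Hom_zero (linear_quiver n) M N \<longleftrightarrow> \<not> (a \<le> c \<and> c < b \<and> b \<le> d)"
proof -
  note M' = interval_classD[OF ab M] and N' = interval_classD[OF cd N]
  have "Hom_zero (linear_quiver n) M N \<longleftrightarrow>
    Hom_zero (linear_quiver n) (interval_mod a b :: (nat, nat, 'k) pmod) (interval_mod c d)"
    by (rule iffI)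
      (erule Hom_zero_iso[OF _ interval_mod_is_mod[OF ab(1,3)] interval_mod_is_mod[OF cd(1,3)] M'(3) N'(3)],
       erule Hom_zero_iso[OF _ M'(1) N'(1) M'(2) N'(2)])
  then show ?thesis by (simp only: Hom_zero_interval_iff[OF ab cd])
qed

text \<open>If \<open>c \<le> a\<close>, then an extension of \<open>[c, d]\<close> by \<open>[a, b]\<close> splits: the kernel vanishes at all
  vertices below \<open>c\<close>, so every lift of the generator of \<open>[c, d]\<close> satisfies the defining relation of
  \<open>[c, d]\<close>.\<close>

lemma Ext1_nonzero_interval_class:
  fixes M N :: "(nat, nat, 'k::field) pmod"
  assumes ab: "1 \<le> a" "a < b" "b \<le> n + 1" and cd: "1 \<le> c" "c < d" "d \<le> n + 1"
    and N: "N \<in> interval_class n a b" and M: "M \<in> interval_class n c d"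
    and ext: "Ext1_nonzero (linear_quiver n) M N"
  shows "a < c"
proof (rule ccontr)
  assume "\<not> a < c"
  then have ca: "c \<le> a" by simp
  note N' = interval_classD[OF ab N] and M' = interval_classD[OF cd M]
  obtain E f g where E: "is_mod (linear_quiver n) E"
    and f: "f \<in> Hom (linear_quiver n) N E" and g: "g \<in> Hom (linear_quiver n) E M"
    and surj: "g ` mcarrier E = mcarrier M"
    and exact: "f ` mcarrier N = {v\<in>mcarrier E. g v = 0}"
    and nosplit: "\<not> (\<exists>s\<in>Hom (linear_quiver n) M E. \<forall>v\<in>mcarrier M. g (s v) = v)"
    using ext unfolding Ext1_nonzero_def by (elim exE bexE conjE) (rule that)
  let ?I = "interval_mod c d :: (nat, nat, 'k) pmod"
  have I: "is_mod (linear_quiver n) ?I" using cd by (intro interval_mod_is_mod)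
  obtain \<phi> where \<phi>: "\<phi> \<in> Hom (linear_quiver n) ?I M" and bij: "bij_betw \<phi> (mcarrier ?I) (mcarrier M)"
    using M'(3) by (auto simp: mod_iso_def)
  define j where "j = d - 1"
  have j: "d = Suc j" "c \<le> j" "1 \<le> j" "j \<le> n" using cd by (auto simp: j_def)
  have ej: "evec j \<in> mcarrier ?I" using j by (intro evec_in_interval) auto
  have "\<phi> (evec j) \<in> g ` mcarrier E" using hom_closed[OF \<phi> ej] by (simp only: surj)
  then obtain e where e: "e \<in> mcarrier E" "g e = \<phi> (evec j)" by (elim imageE) simp
  have ge: "g (mact E (pelem j w) e) = \<phi> (mact ?I (pelem j w) (evec j))" if "1 \<le> w" "w \<le> j" for w
  proof -
    have p: "pelem j w \<in> PA n" using that j by simp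
    show ?thesis by (simp only: hom_act[OF g p e(1)] hom_act[OF \<phi> p ej] e(2))
  qed
  let ?s = "\<lambda>v. mact E (col n j v) e"
  have s: "?s \<in> Hom (linear_quiver n) ?I E"
    unfolding j(1)
  proof (rule interval_generated_hom[OF E e(1) cd(1) j(4)])
    fix w assume w: "1 \<le> w" "w < c" "w \<le> j"
    let ?x = "mact E (pelem j w) e"
    have p: "pelem w w \<in> PA n" "pelem j w \<in> PA n" using w j by simp_all
    have "g ?x = \<phi> 0" using ge[OF w(1,3)] w by (simp add: interval_act_pelem)
    then have "?x \<in> f ` mcarrier N"
      by (simp add: exact mact_closed[OF E p(2) e(1)] hom_0[OF \<phi> mod_zero[OF I]])
    then obtain y where y: "y \<in> mcarrier N" "?x = f y" by (elim imageE)
    \<comment> \<open>The vector comes from \<open>y\<close> in the kernel \<open>N\<close>;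
      applying the idempotent at \<open>w\<close> replaces \<open>y\<close> by its component at
      \<open>w\<close>, which is zero because w < c \<le> a.\<close>
    have "?x = mact E (pelem w w) ?x"
      using w j e(1) by (simp add: mact_pelem_pelem[OF E])
    also have "\<dots> = f (mact N (pelem w w) y)" using hom_act[OF f p(1) y(1)] y(2) by simp
    also have "mact N (pelem w w) y = 0"
      using supported_interval_class[OF ab N, of w] w ca j y(1) by (auto simp: supported_def)
    also have "f 0 = 0" by (rule hom_0[OF f mod_zero[OF N'(1)]])
    finally show "?x = 0" .
  qed
  have "mact E (col n j (evec j)) e = mact E (pelem j j) e" using j by (simp add: col_evec)
  moreover have "mact ?I (pelem j j) (evec j) = evec j" using j by (simp add: interval_act_pelem fun_eq_iff)
  ultimately have "g (?s (evec j)) = \<phi> (evec j)" using ge[of j] j by simp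
  then have gs: "g (?s v) = \<phi> v" if "v \<in> mcarrier ?I" for v
    using interval_hom_eqI[OF cd hom_comp[OF s g] \<phi> _ that] by (simp add: j_def)
  let ?\<psi> = "inv_into (mcarrier ?I) \<phi>"
  have \<psi>: "?\<psi> \<in> Hom (linear_quiver n) M ?I" by (rule hom_inverse(1)[OF \<phi> bij I])
  have "g (?s (?\<psi> v)) = v" if "v \<in> mcarrier M" for v
    using gs[OF hom_closed[OF \<psi> that]] bij_betw_inv_into_right[OF bij that] by simp
  with nosplit hom_comp[OF \<psi> s] show False by fast
qed

section \<open>Non-crossing partitions and their arcs\<close>

definition arc_pairs :: "nat set set \<Rightarrow> (nat \<times> nat) set" where
  "arc_pairs P = {(a, b). is_arc P a b}"

lemma arc_pairs_less: "(a, b) \<in> arc_pairs P \<Longrightarrow> a < b"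
  by (simp add: arc_pairs_def is_arc_def)

lemma arc_pairs_block: "(a, b) \<in> arc_pairs P \<Longrightarrow> \<exists>B\<in>P. a \<in> B \<and> b \<in> B"
  by (auto simp: arc_pairs_def is_arc_def)

lemma partition_on_block_eq:
  "partition_on A P \<Longrightarrow> B \<in> P \<Longrightarrow> B' \<in> P \<Longrightarrow> x \<in> B \<Longrightarrow> x \<in> B' \<Longrightarrow> B = B'"
  unfolding partition_on_def disjoint_def by blast

lemma same_block_trans:
  assumes "partition_on A P" "\<exists>B\<in>P. x \<in> B \<and> y \<in> B" "\<exists>B\<in>P. y \<in> B \<and> z \<in> B"
  shows "\<exists>B\<in>P. x \<in> B \<and> z \<in> B"
  using assms partition_on_block_eq[OF assms(1)] by metis

text \<open>The next element \<open>c\<close> of the block after \<open>a\<close> is the right end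
  of an arc; the rest of the walk is shorter.\<close>

lemma block_imp_arc_rtrancl:
  "B \<in> P \<Longrightarrow> a \<in> B \<Longrightarrow> b \<in> B \<Longrightarrow> a \<le> b \<Longrightarrow> (a, b) \<in> (arc_pairs P)\<^sup>*"
proof (induction "b - a" arbitrary: a rule: less_induct)
  case less
  show ?case
  proof (cases "a = b")
    case False
    then have ab: "a < b" using less.prems by simp
    define c where "c = (LEAST c. a < c \<and> c \<in> B)"
    have c: "a < c \<and> c \<in> B" unfolding c_def by (rule LeastI[of _ b]) (use ab less.prems in simp)
    have least: "c \<le> d" if "a < d" "d \<in> B" for d unfolding c_def by (rule Least_le) (simp add: that)
    have "is_arc P a c"
      unfolding is_arc_def using c less.prems least by (meson not_le)
    then have "(a, c) \<in> arc_pairs P" by (simp add: arc_pairs_def)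
    moreover have "c \<le> b" using least ab less.prems by simp
    then have "(c, b) \<in> (arc_pairs P)\<^sup>*" 
      using less.hyps[of c] c less.prems ab diff_less_mono2[of a c b] by simp
    ultimately show ?thesis by (rule converse_rtrancl_into_rtrancl)
  qed simp
qed

text \<open>The condition \<open>a \<noteq> b\<close> excludes the trivial walks at points outside
  \<open>A\<close>, which lie in no block.\<close>

lemma arc_rtrancl_imp_block:
  assumes P: "partition_on A P" and ab: "(a, b) \<in> (arc_pairs P)\<^sup>*" "a \<noteq> b"
  shows "\<exists>B\<in>P. a \<in> B \<and> b \<in> B"
proof -
  have "(a, b) \<in> (arc_pairs P)\<^sup>+" using ab by (simp add: rtrancl_eq_or_trancl)
  then show ?thesis
  proof (induction rule: trancl_induct)
    case (base b)
    then show ?case by (rule arc_pairs_block)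
  next
    case (step b c)
    show ?case by (rule same_block_trans[OF P step.IH arc_pairs_block[OF step.hyps(2)]])
  qed
qed

text \<open>Brings refinement into the form in which filtrations appear: every arc of
  \<open>P\<close> is spanned by a walk along arcs of \<open>P'\<close>.\<close>

lemma refines_iff_arcs:
  assumes P: "partition_on A P" and P': "partition_on A P'"
  shows "(\<forall>B\<in>P. \<exists>B'\<in>P'. B \<subseteq> B') \<longleftrightarrow> (\<forall>(a, b)\<in>arc_pairs P. (a, b) \<in> (arc_pairs P')\<^sup>*)"
proof
  assume refines: "\<forall>B\<in>P. \<exists>B'\<in>P'. B \<subseteq> B'"
  have "(a, b) \<in> (arc_pairs P')\<^sup>*" if ab: "(a, b) \<in> arc_pairs P" for a b
  proof -
    obtain B where "B \<in> P" "a \<in> B" "b \<in> B" using arc_pairs_block[OF ab] by blast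
    moreover then obtain B' where "B' \<in> P'" "B \<subseteq> B'" using refines by blast
    ultimately show ?thesis
      using block_imp_arc_rtrancl[of B' P' a b] arc_pairs_less[OF ab] by auto
  qed
  then show "\<forall>(a, b)\<in>arc_pairs P. (a, b) \<in> (arc_pairs P')\<^sup>*" by auto
next
  assume arcs: "\<forall>(a, b)\<in>arc_pairs P. (a, b) \<in> (arc_pairs P')\<^sup>*"
  have same: "(a, b) \<in> (arc_pairs P')\<^sup>*" if "B \<in> P" "a \<in> B" "b \<in> B" "a \<le> b" for B a b
    using block_imp_arc_rtrancl[OF that]
  proof (induction rule: rtrancl_induct)
    case (step b c)
    then show ?case using arcs by (auto intro: rtrancl_trans)
  qed simp
  show "\<forall>B\<in>P. \<exists>B'\<in>P'. B \<subseteq> B'"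
  proof
    fix B assume B: "B \<in> P"
    then have "B \<noteq> {}" using P unfolding partition_on_def by blast
    then obtain x where x: "x \<in> B" by blast
    then have "x \<in> A" using P B by (auto simp: partition_on_def)
    then obtain B' where B': "B' \<in> P'" "x \<in> B'" using P' by (auto simp: partition_on_def)
    have "y \<in> B'" if y: "y \<in> B" for y
    proof (cases "x = y")
      case False
      then have "(x, y) \<in> (arc_pairs P')\<^sup>* \<or> (y, x) \<in> (arc_pairs P')\<^sup>*"
        using same[OF B x y] same[OF B y x] linear[of x y] by blast
      then have "\<exists>C\<in>P'. x \<in> C \<and> y \<in> C"
        using arc_rtrancl_imp_block[OF P', of x y] arc_rtrancl_imp_block[OF P', of y x] False by blast
      then show ?thesis using partition_on_block_eq[OF P' _ B'(1) _ B'(2)] by blast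
    qed (use B' in simp)
    with B' show "\<exists>B'\<in>P'. B \<subseteq> B'" by blast
  qed
qed

lemma refines_antisym:
  assumes P: "partition_on A P" and P': "partition_on A P'"
    and le: "\<forall>B\<in>P. \<exists>B'\<in>P'. B \<subseteq> B'" and ge: "\<forall>B\<in>P'. \<exists>B'\<in>P. B \<subseteq> B'"
  shows "P \<subseteq> P'"
proof
  fix B assume B: "B \<in> P"
  then obtain B' B'' where *: "B' \<in> P'" "B \<subseteq> B'" "B'' \<in> P" "B' \<subseteq> B''" using le ge by meson
  have "B \<noteq> {}" using P B by (auto simp: partition_on_def)
  then have "B = B''" using partition_on_block_eq[OF P B *(3)] * by blast
  with * show "B \<in> P'" by auto
qed

lemma partial_order_Nc: "partial_order_on (Nc m) (Nc_order m)"
proof -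
  have "antisym (Nc_order m)"
  proof (rule antisymI)
    fix P P' assume "(P, P') \<in> Nc_order m" "(P', P) \<in> Nc_order m"
    then have "partition_on {1..m} P" "partition_on {1..m} P'"
      and "\<forall>B\<in>P. \<exists>B'\<in>P'. B \<subseteq> B'" "\<forall>B\<in>P'. \<exists>B'\<in>P. B \<subseteq> B'"
      by (simp_all add: Nc_order_def Nc_def)
    then show "P = P'" by (intro subset_antisym refines_antisym[of "{1..m}"])
  qed
  moreover have "trans (Nc_order m)"
  proof (rule transI)
    fix P P' P'' assume *: "(P, P') \<in> Nc_order m" "(P', P'') \<in> Nc_order m"
    have "\<exists>B''\<in>P''. B \<subseteq> B''" if B: "B \<in> P" for B
    proof -
      obtain B' where "B' \<in> P'" "B \<subseteq> B'" using * B unfolding Nc_order_def by blast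
      moreover then obtain B'' where "B'' \<in> P''" "B' \<subseteq> B''" using * unfolding Nc_order_def by blast
      ultimately show ?thesis by (meson subset_trans)
    qed
    with * show "(P, P'') \<in> Nc_order m" by (simp add: Nc_order_def)
  qed
  moreover have "refl_on (Nc m) (Nc_order m)" "Nc_order m \<subseteq> Nc m \<times> Nc m"
    by (auto simp: Nc_order_def refl_on_def)
  ultimately show ?thesis by (simp add: partial_order_on_def preorder_on_def)
qed

text \<open>For two arcs of a partition, \<open>a \<le> c < b \<le> d\<close> would mean a common left end with different
  right ends, a common right end with different left ends, or a crossing.\<close>

lemma Nc_arcs_orthogonal:
  assumes P: "P \<in> Nc m" and ab: "(a, b) \<in> arc_pairs P" and cd: "(c, d) \<in> arc_pairs P"
    and le: "a \<le> c" "c < b" "b \<le> d"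
  shows "a = c \<and> b = d"
proof -
  have part: "partition_on {1..m} P" and nc: "noncrossing P" using P by (auto simp: Nc_def)
  obtain B where B: "B \<in> P" "a \<in> B" "b \<in> B" "\<forall>x. a < x \<and> x < b \<longrightarrow> x \<notin> B"
    using ab by (auto simp: arc_pairs_def is_arc_def)
  obtain C where C: "C \<in> P" "c \<in> C" "d \<in> C" "\<forall>x. c < x \<and> x < d \<longrightarrow> x \<notin> C"
    using cd by (auto simp: arc_pairs_def is_arc_def)
  have "B = C"
  proof (cases "a = c \<or> b = d")
    case True
    then show ?thesis using partition_on_block_eq[OF part] B C by metis
  next
    case False
    then have "a < c" "b < d" using le by auto
    then show ?thesis using nc B C le(2) unfolding noncrossing_def by blast
  qed
  with B C le show ?thesis by (metis le_neq_implies_less)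
qed

lemma arc_pairs_bounds:
  assumes "P \<in> Nc m" "(a, b) \<in> arc_pairs P"
  shows "1 \<le> a \<and> a < b \<and> b \<le> m"
proof -
  obtain B where "B \<in> P" "a \<in> B" "b \<in> B" using arc_pairs_block[OF assms(2)] by blast
  moreover then have "B \<subseteq> {1..m}" using assms(1) by (auto simp: Nc_def partition_on_def)
  ultimately show ?thesis using arc_pairs_less[OF assms(2)] by auto
qed

section \<open>Recovering a non-crossing partition from its arcs\<close>

text \<open>The common ground of both sides: \<open>orthogonal\<close> is the vanishing of Hom
  between distinct intervals, and it is also the property established for arcs of non-crossing
  partitions.\<close>

locale orthogonal_pairs =
  fixes R :: "(nat \<times> nat) set" and m :: nat
  assumes bounds: "(a, b) \<in> R \<Longrightarrow> 1 \<le> a \<and> a < b \<and> b \<le> m"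
    and orthogonal: "(a, b) \<in> R \<Longrightarrow> (c, d) \<in> R \<Longrightarrow> a \<le> c \<Longrightarrow> c < b \<Longrightarrow> b \<le> d \<Longrightarrow> a = c \<and> b = d"
begin

text \<open>Two pairs with a common left end meet the premises of \<open>orthogonal\<close> in one
  of the two orders. With \<open>left_unique\<close>, this makes \<open>R\<close> a disjoint union
  of chains.\<close>

lemma right_unique: "(a, b) \<in> R \<Longrightarrow> (a, d) \<in> R \<Longrightarrow> b = d"
  using orthogonal[of a b a d] orthogonal[of a d a b] bounds[of a b] bounds[of a d]
  by (metis nle_le order_refl)

lemma left_unique: "(a, b) \<in> R \<Longrightarrow> (c, b) \<in> R \<Longrightarrow> a = c"
  using orthogonal[of a b c b] orthogonal[of c b a b] bounds[of a b] bounds[of c b]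
  by (metis nle_le order_refl)

lemma rtrancl_le: "(a, b) \<in> R\<^sup>* \<Longrightarrow> a \<le> b"
  by (induction rule: rtrancl_induct) (auto dest: bounds)

lemma rtrancl_first:
  assumes "(a, b) \<in> R\<^sup>*" "a \<noteq> b"
  obtains s where "(a, s) \<in> R" "(s, b) \<in> R\<^sup>*" "s \<le> b"
  using assms rtrancl_le by (metis converse_rtranclE)

text \<open>By \<open>right_unique\<close>, two walks from the same point follow the same steps, so
  one continues the other.\<close>

lemma forward_linear:
  assumes "(a, b) \<in> R\<^sup>*" "(a, c) \<in> R\<^sup>*"
  shows "(b, c) \<in> R\<^sup>* \<or> (c, b) \<in> R\<^sup>*"
  using assms
proof (induction rule: rtrancl_induct)
  case (step b b')
  then show ?case
    by (metis converse_rtranclE right_unique rtrancl.rtrancl_into_rtrancl rtrancl.rtrancl_refl)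
qed simp

lemma backward_linear:
  assumes "(b, a) \<in> R\<^sup>*" "(c, a) \<in> R\<^sup>*"
  shows "(b, c) \<in> R\<^sup>* \<or> (c, b) \<in> R\<^sup>*"
  using assms
proof (induction rule: converse_rtrancl_induct)
  case (step b b')
  then show ?case
    by (metis rtranclE left_unique converse_rtrancl_into_rtrancl rtrancl.rtrancl_refl)
qed simp

text \<open>As the components of \<open>R\<close> are chains, comparability along walks is already
  transitive, and no symmetric closure has to be taken. Points that occur in no pair become
  singleton blocks.\<close>

definition conn :: "(nat \<times> nat) set" where
  "conn = {(x, y) \<in> {1..m} \<times> {1..m}. (x, y) \<in> R\<^sup>* \<or> (y, x) \<in> R\<^sup>*}"

lemma equiv_conn: "equiv {1..m} conn"
proof (rule equivI)
  show "trans conn"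
  proof (rule transI)
    fix x y z assume "(x, y) \<in> conn" "(y, z) \<in> conn"
    then show "(x, z) \<in> conn"
      unfolding conn_def using forward_linear[of y x z] backward_linear[of x y z]
      by (auto intro: rtrancl_trans)
  qed
qed (auto simp: conn_def refl_on_def sym_def)

definition blocks :: "nat set set" where
  "blocks = {1..m} // conn"

lemma partition_blocks: "partition_on {1..m} blocks"
  unfolding blocks_def by (rule partition_on_quotient[OF equiv_conn])

lemma same_block_iff: "(\<exists>B\<in>blocks. x \<in> B \<and> y \<in> B) \<longleftrightarrow> (x, y) \<in> conn"
proof
  assume "\<exists>B\<in>blocks. x \<in> B \<and> y \<in> B"
  then show "(x, y) \<in> conn"
    unfolding blocks_def using quotient_eq_iff[OF equiv_conn] by blast
next
  assume xy: "(x, y) \<in> conn"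
  then have "x \<in> {1..m}" by (auto simp: conn_def)
  with xy show "\<exists>B\<in>blocks. x \<in> B \<and> y \<in> B"
    unfolding blocks_def
    using equiv_class_self[OF equiv_conn, of x]
    by (intro bexI[of _ "conn `` {x}"] quotientI) auto
qed

lemma conn_less: "(x, y) \<in> conn \<Longrightarrow> x < y \<Longrightarrow> (x, y) \<in> R\<^sup>*"
  using rtrancl_le[of y x] by (auto simp: conn_def)

text \<open>The steps \<open>(p, q)\<close> of a walk from \<open>i\<close> to \<open>j\<close>,
  read as half-open intervals from \<open>p\<close> to \<open>q\<close>, tile the one from
  \<open>i\<close> to \<open>j\<close>, so one of them covers \<open>x\<close>.\<close>

lemma arc_over:
  assumes "(i, j) \<in> R\<^sup>*" "i \<le> x" "x < j"
  obtains p q where "(p, q) \<in> R" "(i, p) \<in> R\<^sup>*" "p \<le> x" "x < q" "(q, j) \<in> R\<^sup>*"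
  using assms
proof (induction arbitrary: thesis rule: converse_rtrancl_induct)
  case (step i i')
  show ?case
  proof (cases "x < i'")
    case True
    then show ?thesis using step by (intro step.prems(1)[of i i']) auto
  next
    case False
    then obtain p q where "(p, q) \<in> R" "(i', p) \<in> R\<^sup>*" "p \<le> x" "x < q" "(q, j) \<in> R\<^sup>*"
      using step.IH step.prems by (metis not_less)
    with step.hyps(1) show ?thesis
      by (intro step.prems(1)[of p q]) (auto intro: converse_rtrancl_into_rtrancl)
  qed
qed auto

text \<open>The arc over \<open>i'\<close> on the walk from \<open>i\<close> to \<open>j\<close> is
  compared with a suitable arc on the walk from \<open>i'\<close> to \<open>j'\<close>.
  Orthogonality makes them equal, which forces the first walk to pass through
  \<open>i'\<close>.\<close>

lemma noncrossing_blocks: "noncrossing blocks"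
  unfolding noncrossing_def
proof (intro ballI allI impI, elim conjE)
  fix B B' i i' j j' assume B: "B \<in> blocks" "B' \<in> blocks"
    and ord: "i < i'" "i' < j" "j < j'" and mem: "i \<in> B" "j \<in> B" "i' \<in> B'" "j' \<in> B'"
  have ij: "(i, j) \<in> R\<^sup>*" and ij': "(i', j') \<in> R\<^sup>*"
    using B mem ord same_block_iff conn_less[of i j] conn_less[of i' j'] by auto
  obtain p q where pq: "(p, q) \<in> R" "(i, p) \<in> R\<^sup>*" "p \<le> i'" "i' < q" "(q, j) \<in> R\<^sup>*"
    by (rule arc_over[OF ij less_imp_le[OF ord(1)] ord(2)])
  have qj: "q \<le> j" by (rule rtrancl_le[OF pq(5)])
  \<comment> \<open>Covering the position \<open>q - 1\<close> means r < q \<le> s. Together with p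
    \<le> i' \<le> r these are exactly the premises of \<open>orthogonal\<close>.\<close>
  obtain r s where rs: "(r, s) \<in> R" "(i', r) \<in> R\<^sup>*" "r \<le> q - 1" "q - 1 < s" "(s, j') \<in> R\<^sup>*"
    by (rule arc_over[OF ij', of "q - 1"]) (use pq(4) qj ord in auto)
  have "i' \<le> r" by (rule rtrancl_le[OF rs(2)])
  then have "p = r \<and> q = s" using orthogonal[OF pq(1) rs(1)] pq(3,4) rs(3,4) by linarith
  then have "p = i'" using pq(3) \<open>i' \<le> r\<close> by simp
  then have "(i, i') \<in> R\<^sup>*" using pq(2) by simp
  moreover have "i \<in> {1..m}" "i' \<in> {1..m}"
    using B mem partition_blocks unfolding partition_on_def by blast+
  ultimately have "(i, i') \<in> conn" by (simp add: conn_def)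
  then obtain C where "C \<in> blocks" "i \<in> C" "i' \<in> C" using same_block_iff by blast
  then show "B = B'" using partition_on_block_eq[OF partition_blocks] B mem by metis
qed

lemma blocks_in_Nc: "blocks \<in> Nc m"
  unfolding Nc_def using partition_blocks noncrossing_blocks by blast

text \<open>Both inclusions look at the first step \<open>(a, s)\<close> of a walk from
  \<open>a\<close>. For an arc, \<open>s\<close> lies in the block and cannot be strictly between
  the ends, so \<open>s = b\<close>. For a pair in \<open>R\<close>, a block element between the
  ends would give a second step from \<open>a\<close>, against \<open>right_unique\<close>.\<close>

lemma arc_pairs_blocks: "arc_pairs blocks = R"
proof (intro subset_antisym subrelI)
  fix a b assume "(a, b) \<in> arc_pairs blocks"
  then obtain B where B: "B \<in> blocks" "a \<in> B" "b \<in> B" "a < b" "\<forall>x. a < x \<and> x < b \<longrightarrow> x \<notin> B"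
    by (auto simp: arc_pairs_def is_arc_def)
  then have "(a, b) \<in> R\<^sup>*" using same_block_iff conn_less by blast
  then obtain s where s: "(a, s) \<in> R" "(s, b) \<in> R\<^sup>*" "s \<le> b" using rtrancl_first B(4) by blast
  have "(a, s) \<in> conn" using s(1) bounds[OF s(1)] by (auto simp: conn_def)
  then obtain C where "C \<in> blocks" "a \<in> C" "s \<in> C" using same_block_iff by blast
  then have "s \<in> B" using partition_on_block_eq[OF partition_blocks] B by blast
  then have "s = b" using B(5) s(3) bounds[OF s(1)] by (metis le_neq_implies_less)
  with s show "(a, b) \<in> R" by simp
next
  fix a b assume ab: "(a, b) \<in> R"
  then have "(a, b) \<in> conn" using bounds[OF ab] by (auto simp: conn_def)
  then obtain B where B: "B \<in> blocks" "a \<in> B" "b \<in> B" using same_block_iff by blast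
  have "x \<notin> B" if x: "a < x" "x < b" for x
  proof
    assume "x \<in> B"
    then have "(a, x) \<in> R\<^sup>*" using B x same_block_iff conn_less by blast
    then obtain s where s: "(a, s) \<in> R" "s \<le> x" using rtrancl_first x(1) by blast
    then have "s = b" using right_unique[OF ab] by simp
    with s x show False by simp
  qed
  with B bounds[OF ab] show "(a, b) \<in> arc_pairs blocks"
    by (auto simp: arc_pairs_def is_arc_def)
qed

end

section \<open>Antichains of interval modules\<close>

definition interval_classes :: "nat \<Rightarrow> (nat \<times> nat) set \<Rightarrow> (nat, nat, 'k::field) pmod set set" where
  "interval_classes n R = {interval_class n a b |a b. (a, b) \<in> R}"

lemma arc_antichain_eq: "arc_antichain n P = interval_classes n (arc_pairs P)"
  by (simp add: arc_antichain_def interval_classes_def arc_pairs_def)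

definition valid_pairs :: "nat \<Rightarrow> (nat \<times> nat) set" where
  "valid_pairs n = {(a, b). 1 \<le> a \<and> a < b \<and> b \<le> n + 1}"

lemma valid_pairsD: "(a, b) \<in> valid_pairs n \<Longrightarrow> 1 \<le> a" "(a, b) \<in> valid_pairs n \<Longrightarrow> a < b"
  "(a, b) \<in> valid_pairs n \<Longrightarrow> b \<le> n + 1"
  by (simp_all add: valid_pairs_def)

lemma interval_class_eqD:
  assumes ab: "(a, b) \<in> valid_pairs n" and cd: "(c, d) \<in> valid_pairs n"
    and eq: "(interval_class n a b :: (nat, nat, 'k::field) pmod set) = interval_class n c d"
  shows "a = c \<and> b = d"
proof -
  have mem: "(interval_mod a b :: (nat, nat, 'k) pmod) \<in> interval_class n a b"
    by (rule interval_mod_in_class[OF valid_pairsD[OF ab]])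
  show ?thesis
    by (rule interval_class_inject[OF valid_pairsD[OF ab] valid_pairsD[OF cd] mem mem[unfolded eq]])
qed

text \<open>A rank function on classes; the arrows of the Ext-quiver strictly decrease it.\<close>

definition left_end :: "nat \<Rightarrow> (nat, nat, 'k::field) pmod set \<Rightarrow> nat" where
  "left_end n X = (SOME a. \<exists>b. (a, b) \<in> valid_pairs n \<and> X = interval_class n a b)"

lemma left_end_class:
  assumes ab: "(a, b) \<in> valid_pairs n"
  shows "left_end n (interval_class n a b :: (nat, nat, 'k::field) pmod set) = a"
  unfolding left_end_def
proof (rule some_equality)
  show "\<exists>b'. (a, b') \<in> valid_pairs n \<and>
      (interval_class n a b :: (nat, nat, 'k) pmod set) = interval_class n a b'"
    using ab by (intro exI[of _ b]) simp
  fix c assume "\<exists>d. (c, d) \<in> valid_pairs n \<and>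
      (interval_class n a b :: (nat, nat, 'k) pmod set) = interval_class n c d"
  then obtain d where "(c, d) \<in> valid_pairs n"
    and "(interval_class n a b :: (nat, nat, 'k) pmod set) = interval_class n c d"
    by (elim exE conjE) (rule that)
  from interval_class_eqD[OF ab this] show "c = a" by simp
qed

lemma interval_classesE:
  assumes "X \<in> interval_classes n R"
  obtains a b where "(a, b) \<in> R" "X = interval_class n a b"
  using assms unfolding interval_classes_def by (elim CollectE exE conjE) (rule that)

lemma interval_classesI: "(a, b) \<in> R \<Longrightarrow> interval_class n a b \<in> interval_classes n R"
  unfolding interval_classes_def by (rule CollectI, rule exI, rule exI, rule conjI[OF refl])

lemma orthogonal_pairs_valid: "orthogonal_pairs R (n + 1) \<Longrightarrow> R \<subseteq> valid_pairs n"
  unfolding orthogonal_pairs_def valid_pairs_def by auto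

lemma interval_classes_exceptional:
  assumes R: "orthogonal_pairs R (n + 1)"
  shows "(interval_classes n R :: (nat, nat, 'k::field) pmod set set) \<in> exceptional_antichains (linear_quiver n)"
proof -
  let ?A = "interval_classes n R :: (nat, nat, 'k) pmod set set"
  have valid: "(a, b) \<in> valid_pairs n" if "(a, b) \<in> R" for a b
    using orthogonal_pairs_valid[OF R] that by auto
  have "\<exists>M. brick (linear_quiver n) M \<and> X = iso_class (linear_quiver n) M" if "X \<in> ?A" for X
    using that
  proof (rule interval_classesE)
    fix a b assume "(a, b) \<in> R" and X: "X = interval_class n a b"
    note ab = valid_pairsD[OF valid[OF this(1)]]
    show ?thesis
      unfolding X interval_class_eq[OF ab]
      by (intro exI[of _ "interval_mod a b"] conjI brick_interval[OF ab] refl)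
  qed
  moreover have "Hom_zero (linear_quiver n) M N"
    if X': "X \<in> ?A" and Y': "Y \<in> ?A" and neq: "X \<noteq> Y" and MN: "M \<in> X" "N \<in> Y" for X Y M N
  proof -
    obtain a b where ab: "(a, b) \<in> R" and X: "X = interval_class n a b" using X' by (rule interval_classesE)
    obtain c d where cd: "(c, d) \<in> R" and Y: "Y = interval_class n c d" using Y' by (rule interval_classesE)
    have "\<not> (a = c \<and> b = d)" using neq X Y by blast
    then have "\<not> (a \<le> c \<and> c < b \<and> b \<le> d)"
      using orthogonal_pairs.orthogonal[OF R ab cd] by blast
    then show ?thesis
      using Hom_zero_interval_class[OF valid_pairsD[OF valid[OF ab]] valid_pairsD[OF valid[OF cd]]] MN
      unfolding X Y by simp
  qed
  ultimately have "antichain (linear_quiver n) ?A"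
    unfolding antichain_def by (intro conjI ballI impI) (blast, simp_all)
  \<comment> \<open>The converse appears because an arrow from \<open>X\<close> to \<open>Y\<close>
    goes to the smaller left end, and \<open>measure\<close> lists the smaller element
    first.\<close>
  moreover have "ext_quiver (linear_quiver n) ?A \<subseteq> (measure (left_end n))\<inverse>"
  proof (rule subrelI)
    fix X Y assume "(X, Y) \<in> ext_quiver (linear_quiver n) ?A"
    then obtain M N where XY: "X \<in> ?A" "Y \<in> ?A" and MN: "M \<in> X" "N \<in> Y" "Ext1_nonzero (linear_quiver n) M N"
      unfolding ext_quiver_def by blast
    obtain c d where cd: "(c, d) \<in> R" and X: "X = interval_class n c d" using XY(1) by (rule interval_classesE)
    obtain a b where ab: "(a, b) \<in> R" and Y: "Y = interval_class n a b" using XY(2) by (rule interval_classesE)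
    have "a < c"
      using Ext1_nonzero_interval_class[OF valid_pairsD[OF valid[OF ab]] valid_pairsD[OF valid[OF cd]]] MN
      unfolding X Y by blast
    then show "(X, Y) \<in> (measure (left_end n))\<inverse>"
      unfolding X Y by (simp add: left_end_class valid ab cd)
  qed
  then have "acyclic (ext_quiver (linear_quiver n) ?A)"
    by (rule acyclic_subset[rotated]) (simp add: acyclic_converse wf_acyclic)
  ultimately show ?thesis by (simp add: exceptional_antichains_def)
qed

text \<open>\<open>R\<close> collects the pairs whose class belongs to \<open>A\<close>. Since every
  brick is an interval module, nothing of \<open>A\<close> is lost, and the vanishing of Hom between
  the models gives orthogonality.\<close>

lemma exceptional_is_interval_classes:
  assumes A: "(A :: (nat, nat, 'k::field) pmod set set) \<in> exceptional_antichains (linear_quiver n)"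
  obtains R where "orthogonal_pairs R (n + 1)" "A = interval_classes n R"
proof -
  have bricks: "\<forall>X\<in>A. \<exists>M. brick (linear_quiver n) M \<and> X = iso_class (linear_quiver n) M"
    and hom: "\<forall>X\<in>A. \<forall>Y\<in>A. X \<noteq> Y \<longrightarrow> (\<forall>M\<in>X. \<forall>N\<in>Y. Hom_zero (linear_quiver n) M N \<and> Hom_zero (linear_quiver n) N M)"
    using A unfolding exceptional_antichains_def antichain_def by simp_all
  define R where "R = {(a, b). (a, b) \<in> valid_pairs n \<and> (interval_class n a b :: (nat, nat, 'k) pmod set) \<in> A}"
  have R: "(a, b) \<in> valid_pairs n" "(interval_class n a b :: (nat, nat, 'k) pmod set) \<in> A"
    if "(a, b) \<in> R" for a b using that by (simp_all add: R_def)
  have "orthogonal_pairs R (n + 1)"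
  proof
    show "1 \<le> a \<and> a < b \<and> b \<le> n + 1" if "(a, b) \<in> R" for a b
      using valid_pairsD[OF R(1)[OF that]] by simp
    fix a b c d assume ab: "(a, b) \<in> R" and cd: "(c, d) \<in> R" and le: "a \<le> c" "c < b" "b \<le> d"
    note v = valid_pairsD[OF R(1)[OF ab]] and w = valid_pairsD[OF R(1)[OF cd]]
    show "a = c \<and> b = d"
    proof (rule interval_class_eqD[OF R(1)[OF ab] R(1)[OF cd]], rule ccontr)
      assume "(interval_class n a b :: (nat, nat, 'k) pmod set) \<noteq> interval_class n c d"
      then have "Hom_zero (linear_quiver n) (interval_mod a b :: (nat, nat, 'k) pmod) (interval_mod c d)"
        using hom[rule_format, OF R(2)[OF ab] R(2)[OF cd] _ interval_mod_in_class[OF v] interval_mod_in_class[OF w]]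
        by simp
      then show False unfolding Hom_zero_interval_iff[OF v w] using le by simp
    qed
  qed
  moreover have "A = interval_classes n R"
  proof (intro set_eqI iffI)
    fix X assume X: "X \<in> A"
    then obtain M where M: "brick (linear_quiver n) M" "X = iso_class (linear_quiver n) M"
      using bricks by blast
    obtain a b where ab: "1 \<le> a" "a < b" "b \<le> n + 1" and iso: "mod_iso (linear_quiver n) M (interval_mod a b)"
      by (rule brick_iso_interval[OF M(1)])
    have "is_mod (linear_quiver n) M" using M(1) by (simp add: brick_def)
    then have "X = interval_class n a b"
      unfolding M(2) interval_class_eq[OF ab]
      by (rule iso_class_eq[OF _ interval_mod_is_mod[OF ab(1,3)] iso])
    moreover have "(a, b) \<in> R" using ab X calculation by (simp add: R_def valid_pairs_def)
    ultimately show "X \<in> interval_classes n R" by (simp add: interval_classesI)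
  next
    fix X :: "(nat, nat, 'k) pmod set" assume "X \<in> interval_classes n R"
    then show "X \<in> A"
    proof (rule interval_classesE)
      fix a b assume "(a, b) \<in> R" "X = interval_class n a b"
      then show "X \<in> A" using R(2) by simp
    qed
  qed
  ultimately show thesis by (rule that)
qed

lemma filtration_class_iff:
  fixes M :: "(nat, nat, 'k::field) pmod"
  assumes ab: "(a, b) \<in> valid_pairs n" and M: "M \<in> interval_class n a b" and R: "R \<subseteq> valid_pairs n"
  shows "(\<exists>t F. (\<forall>i<t. F i \<in> \<Union>(interval_classes n R)) \<and> filtration_with_factors (linear_quiver n) M t F)
    \<longleftrightarrow> (a, b) \<in> R\<^sup>*"
proof -
  note v = valid_pairsD[OF ab]
  obtain g where "interval_coords n a b M g"
    by (rule interval_coords_exists[OF v interval_classD(1,2)[OF v M]])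
  then interpret interval_coords n a b M g .
  show ?thesis
    unfolding interval_classes_def
    by (rule filtration_iff_rtrancl) (use R in \<open>auto simp: valid_pairs_def\<close>)
qed

lemma interval_classes_le_iff:
  assumes R: "R \<subseteq> valid_pairs n" and R': "R' \<subseteq> valid_pairs n"
  shows "(\<forall>X\<in>interval_classes n R. \<forall>M\<in>X. \<exists>t F. (\<forall>i<t. F i \<in> \<Union>(interval_classes n R' :: (nat, nat, 'k::field) pmod set set)) \<and>
      filtration_with_factors (linear_quiver n) M t F) \<longleftrightarrow> (\<forall>(a, b)\<in>R. (a, b) \<in> R'\<^sup>*)"
    (is "?L \<longleftrightarrow> ?R")
proof
  assume L: ?L
  have "(a, b) \<in> R'\<^sup>*" if ab: "(a, b) \<in> R" for a b
  proof -
    have v: "(a, b) \<in> valid_pairs n" using R ab by blast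
    note M = interval_mod_in_class[OF valid_pairsD[OF v], where ?'a = 'k]
    show ?thesis
      using L[rule_format, OF interval_classesI[OF ab] M] by (simp only: filtration_class_iff[OF v M R'])
  qed
  then show ?R by blast
next
  assume ?R
  show ?L
  proof (intro ballI)
    fix X and M :: "(nat, nat, 'k) pmod" assume X: "X \<in> interval_classes n R" and M: "M \<in> X"
    obtain a b where ab: "(a, b) \<in> R" and eq: "X = interval_class n a b" using X by (rule interval_classesE)
    have v: "(a, b) \<in> valid_pairs n" using R ab by blast
    show "\<exists>t F. (\<forall>i<t. F i \<in> \<Union>(interval_classes n R')) \<and> filtration_with_factors (linear_quiver n) M t F"
      unfolding filtration_class_iff[OF v M[unfolded eq] R'] using \<open>?R\<close> ab by blast
  qed
qed

section \<open>Comparison of the two posets\<close>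

lemma Nc_orthogonal_pairs:
  assumes "P \<in> Nc (n + 1)"
  shows "orthogonal_pairs (arc_pairs P) (n + 1)"
proof
  show "1 \<le> a \<and> a < b \<and> b \<le> n + 1" if "(a, b) \<in> arc_pairs P" for a b
    by (rule arc_pairs_bounds[OF assms that])
  show "a = c \<and> b = d" if "(a, b) \<in> arc_pairs P" "(c, d) \<in> arc_pairs P" "a \<le> c" "c < b" "b \<le> d" for a b c d
    by (rule Nc_arcs_orthogonal[OF assms that])
qed

text \<open>If \<open>f x = f y\<close>, reflexivity pulled back along \<open>iff\<close> gives both
  comparisons of \<open>x\<close> and \<open>y\<close>, so antisymmetry of \<open>r\<close> yields
  injectivity. The axioms for \<open>s\<close> follow by choosing preimages.\<close>

lemma poset_isomorphismI:
  assumes r: "partial_order_on S r" and s: "s \<subseteq> T \<times> T" and onto: "f ` S = T"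
    and iff: "\<And>x y. x \<in> S \<Longrightarrow> y \<in> S \<Longrightarrow> (x, y) \<in> r \<longleftrightarrow> (f x, f y) \<in> s"
  shows "poset_isomorphism S r T s f"
proof -
  have refl: "(x, x) \<in> r" if "x \<in> S" for x
    using r that by (auto simp: partial_order_on_def preorder_on_def refl_on_def)
  have anti: "x = y" if "(x, y) \<in> r" "(y, x) \<in> r" for x y
    using r that by (auto simp: partial_order_on_def antisym_def)
  have trans: "(x, z) \<in> r" if "(x, y) \<in> r" "(y, z) \<in> r" for x y z
    using r that unfolding partial_order_on_def preorder_on_def by (blast dest: transD)
  have "inj_on f S"
  proof (rule inj_onI)
    fix x y assume xy: "x \<in> S" "y \<in> S" "f x = f y"
    then show "x = y" using anti iff[of x y] iff[of y x] iff[of x x] refl[of x] by simp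
  qed
  moreover have "partial_order_on T s"
    unfolding partial_order_on_def preorder_on_def
  proof (intro conjI s refl_onI transI antisymI)
    fix y assume "y \<in> T"
    then obtain x where "x \<in> S" "y = f x" using onto by blast
    then show "(y, y) \<in> s" using refl iff by simp
  next
    fix u v w assume *: "(u, v) \<in> s" "(v, w) \<in> s"
    then obtain x y z where "x \<in> S" "y \<in> S" "z \<in> S" "u = f x" "v = f y" "w = f z"
      using s onto by blast
    then show "(u, w) \<in> s" using * iff trans by metis
  next
    fix u v assume *: "(u, v) \<in> s" "(v, u) \<in> s"
    then obtain x y where "x \<in> S" "y \<in> S" "u = f x" "v = f y" using s onto by blast
    then show "u = v" using * iff anti by metis
  qed
  ultimately show ?thesis
    unfolding poset_isomorphism_def bij_betw_def using r onto iff by blast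
qed

theorem theorem4p2p2p2:
  fixes n :: nat
  assumes "n \<ge> 1"
  shows "poset_isomorphism (Nc (n + 1)) (Nc_order (n + 1))
           (exceptional_antichains (linear_quiver n) :: (nat, nat, 'k::field) pmod set set set)
           (antichain_order (linear_quiver n))
           (arc_antichain n)"
proof (rule poset_isomorphismI[OF partial_order_Nc])
  let ?T = "exceptional_antichains (linear_quiver n) :: (nat, nat, 'k) pmod set set set"
  show "antichain_order (linear_quiver n) \<subseteq> ?T \<times> ?T"
    unfolding antichain_order_def by blast
  have into: "(interval_classes n (arc_pairs P) :: (nat, nat, 'k) pmod set set) \<in> ?T" if "P \<in> Nc (n + 1)" for P
    by (rule interval_classes_exceptional[OF Nc_orthogonal_pairs[OF that]])
  show "arc_antichain n ` Nc (n + 1) = ?T"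
  proof (intro subset_antisym subsetI)
    fix A :: "(nat, nat, 'k) pmod set set" assume "A \<in> arc_antichain n ` Nc (n + 1)"
    then obtain P where "P \<in> Nc (n + 1)" "A = arc_antichain n P" by (elim imageE)
    then show "A \<in> ?T" using into by (simp only: arc_antichain_eq)
  next
    fix A :: "(nat, nat, 'k) pmod set set" assume "A \<in> ?T"
    then obtain R where R: "orthogonal_pairs R (n + 1)" and A: "A = interval_classes n R"
      by (rule exceptional_is_interval_classes)
    show "A \<in> arc_antichain n ` Nc (n + 1)"
    proof (rule image_eqI)
      show "A = arc_antichain n (orthogonal_pairs.blocks R (n + 1))"
        by (simp only: arc_antichain_eq orthogonal_pairs.arc_pairs_blocks[OF R] A)
      show "orthogonal_pairs.blocks R (n + 1) \<in> Nc (n + 1)"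
        by (rule orthogonal_pairs.blocks_in_Nc[OF R])
    qed
  qed
  fix P P' assume P: "P \<in> Nc (n + 1)" and P': "P' \<in> Nc (n + 1)"
  have part: "partition_on {1..n + 1} P" "partition_on {1..n + 1} P'"
    using P P' unfolding Nc_def by blast+
  \<comment> \<open>Both orders reduce to the same condition: each arc of \<open>P\<close> is
    spanned by a walk along arcs of \<open>P'\<close>.\<close>
  have "(P, P') \<in> Nc_order (n + 1) \<longleftrightarrow> (\<forall>(a, b)\<in>arc_pairs P. (a, b) \<in> (arc_pairs P')\<^sup>*)"
    using P P' refines_iff_arcs[OF part] by (simp add: Nc_order_def)
  also have "\<dots> \<longleftrightarrow> (interval_classes n (arc_pairs P), interval_classes n (arc_pairs P') :: (nat, nat, 'k) pmod set set)
      \<in> antichain_order (linear_quiver n)"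
    using into[OF P] into[OF P']
      interval_classes_le_iff[OF orthogonal_pairs_valid[OF Nc_orthogonal_pairs[OF P]]
        orthogonal_pairs_valid[OF Nc_orthogonal_pairs[OF P']], where ?'k = 'k]
    unfolding antichain_order_def by simp
  finally show "(P, P') \<in> Nc_order (n + 1) \<longleftrightarrow>
      (arc_antichain n P, arc_antichain n P' :: (nat, nat, 'k) pmod set set) \<in> antichain_order (linear_quiver n)"
    by (simp only: arc_antichain_eq)
qed

end
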